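(* The fiber $\operatorname{Diff}^+(S^1)$ of $\operatorname{Imm}^0(S^1,\mathbb R^2)\to B^{0,+}(S^1,\mathbb R^2)$ maps homotopically trivially into the total space: for $c\in\operatorname{Imm}^0(S^1,\mathbb R^2)$, the map $$c^*:\operatorname{Diff}^+(S^1)\to\operatorname{Imm}^0(S^1,\mathbb R^2),\qquad c^*(f)=c\circ f,$$ is homotopic to a constant map.
   Context: For a smooth immersion $c:S^1\to\mathbb R^2$ the (rotation) degree is the winding number of $c':S^1\to\mathbb R^2\setminus\{0\}$ around $0$, where $c$ is viewed as a $2\pi$-periodic function of $\theta$. $\operatorname{Imm}^0(S^1,\mathbb R^2)$ is the space of all smooth immersions $S^1\to\mathbb R^2$ of degree $0$, with the $C^\infty$-topology; it is connected. $\operatorname{Diff}^+(S^1)$ is the group of orientation preserving smooth diffeomorphisms of $S^1$ with the $C^\infty$-topology, acting on $\operatorname{Imm}^0(S^1,\mathbb R^2)$ from the right by $c\mapsto c\circ f$, and $B^{0,+}(S^1,\mathbb R^2)=\operatorname{Imm}^0(S^1,\mathbb R^2)/\operatorname{Diff}^+(S^1)$ with the quotient topology. *)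

theory Defs
  imports "HOL-Complex_Analysis.Complex_Analysis"
begin

text \<open>
  The circle $S^1$ is the unit circle in the complex plane and $\mathbb{R}^2$ is the type
  \<^typ>\<open>complex\<close>. A map on $S^1$ is a function of type \<^typ>\<open>complex \<Rightarrow> complex\<close> that is
  \<^const>\<open>extensional\<close> on the circle, so that equality of functions is equality of maps on $S^1$.
\<close>

abbreviation circle :: "complex set" where
  "circle \<equiv> sphere 0 1"

text \<open>
  The $k$-th derivative of $c$, viewed as the $2\pi$-periodic function
  $\theta \mapsto c(e^{i\theta})$.
\<close>

definition circle_deriv :: "nat \<Rightarrow> (complex \<Rightarrow> complex) \<Rightarrow> real \<Rightarrow> complex" where
  "circle_deriv k c =
     ((\<lambda>g \<theta>. vector_derivative g (at \<theta>)) ^^ k) (\<lambda>\<theta>. c (cis \<theta>))"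

definition smooth_maps :: "(complex \<Rightarrow> complex) set" where
  "smooth_maps =
     {c \<in> extensional circle. \<forall>k \<theta>. circle_deriv k c differentiable (at \<theta>)}"

text \<open>
  The $C^\infty$-topology on all smooth maps from $S^1$ to $\mathbb{R}^2$: uniform convergence of
  every derivative.
\<close>

definition Cinf_topology :: "(complex \<Rightarrow> complex) topology" where
  "Cinf_topology = topology_generated_by
     {{d \<in> smooth_maps. \<forall>\<theta>. norm (circle_deriv k d \<theta> - circle_deriv k c \<theta>) < \<epsilon>} |
        c k \<epsilon>. c \<in> smooth_maps \<and> 0 < \<epsilon>}"

lemma topspace_Cinf_topology [simp]: "topspace Cinf_topology = smooth_maps"
proof -
  have "c \<in> {d \<in> smooth_maps. \<forall>\<theta>. norm (circle_deriv 0 d \<theta> - circle_deriv 0 c \<theta>) < 1}"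
    if "c \<in> smooth_maps" for c
    using that by simp
  moreover have "(0::real) < 1" by simp
  ultimately show ?thesis
    unfolding Cinf_topology_def topology_generated_by_topspace by blast
qed

definition immersions :: "(complex \<Rightarrow> complex) set" where
  "immersions = {c \<in> smooth_maps. \<forall>\<theta>. circle_deriv 1 c \<theta> \<noteq> 0}"

text \<open>\<^const>\<open>winding_number\<close> expects a loop parametrised by the unit interval.\<close>

definition rotation_degree :: "(complex \<Rightarrow> complex) \<Rightarrow> complex" where
  "rotation_degree c = winding_number (\<lambda>t. circle_deriv 1 c (2 * pi * t)) 0"

definition Imm0 :: "(complex \<Rightarrow> complex) set" where
  "Imm0 = {c \<in> immersions. rotation_degree c = 0}"

definition Imm0_topology :: "(complex \<Rightarrow> complex) topology" where
  "Imm0_topology = subtopology Cinf_topology Imm0"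

definition diffeomorphisms :: "(complex \<Rightarrow> complex) set" where
  "diffeomorphisms =
     {f \<in> smooth_maps. bij_betw f circle circle \<and>
        restrict (inv_into circle f) circle \<in> smooth_maps}"

text \<open>
  The positively oriented unit tangent vector of $S^1$ at $z$ is $iz$. So $f$ preserves orientation
  iff its differential maps it to a positive multiple of the one at $f(z)$.
\<close>

definition orientation_preserving :: "(complex \<Rightarrow> complex) \<Rightarrow> bool" where
  "orientation_preserving f \<longleftrightarrow>
     (\<forall>\<theta>. \<exists>r>0. circle_deriv 1 f \<theta> = of_real r * (\<i> * f (cis \<theta>)))"

definition Diff_plus :: "(complex \<Rightarrow> complex) set" where
  "Diff_plus = {f \<in> diffeomorphisms. orientation_preserving f}"

text \<open>
  Since $S^1$ is an embedded submanifold of the plane, the $C^\infty$-topology on maps from $S^1$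
  to $S^1$ is the one induced from maps into the plane.
\<close>

definition Diff_plus_topology :: "(complex \<Rightarrow> complex) topology" where
  "Diff_plus_topology = subtopology Cinf_topology Diff_plus"

end

theory Submission
  imports Defs
begin

text \<open>
  Write $c'(\theta) = e^{L(\theta)}$ with a smooth $L$. Since $c$ has degree $0$, $L$ is
  $2\pi$-periodic, so the tangent angle $\psi = \operatorname{Im} L$ is a real function on the
  circle. This is the only use of the degree, and it is decisive: for every orientation preserving
  $f$ the velocity of $c \circ f$ is $W e^{i \psi \circ f}$ with a positive speed $W$, and
  $\psi \circ f$ is determined by $f$ without choosing a lift of $f$. Speeds and angles are points
  of convex sets, so the pair $(W, \psi \circ f)$ can be moved along a straight line to a pair
  $(1, \chi)$ that does not depend on $f$.

  Along the way the curves have to stay closed and immersed. A speed $w > 0$ and an angle $\phi$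
  give the velocity $w (e^{i\phi} - m)$, where $m$ is the mean of $e^{i\phi}$ with weight $w$; it
  has integral $0$, so its primitive is a closed curve. Being an average of unit vectors, $m$ has
  norm at most $1$, and the norm is less than $1$ as soon as $\phi$ is not constant
  (\<open>norm_mean_direction_less_1\<close>). In that case the velocity vanishes nowhere, and since
  $e^{i\phi} - m = e^{i\phi} (1 - m e^{-i\phi})$ with $1 - m e^{-i\phi}$ in the right half plane, the
  degree is $0$ again. At time $0$ no correction takes place, because $c \circ f$ is closed already
  and so $m = 0$. The resulting immersion of degree $0$ depends continuously on $(w, \phi)$
  (\<open>continuous_map_closed_curve\<close>).

  It remains to choose $\chi$ such that $(1 - t) (\psi \circ f) + t \chi$ is not constant for
  $0 < t \le 1$ and every $f$, that is, such that $\chi$ is not of the form $A + B (\psi \circ f)$.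
  One of $\cos\theta$ and $\cos 2\theta$ will do (\<open>exists_transverse_angle\<close>): otherwise the two
  would agree up to a bijection of the circle and an affine map of the line, but the values of the
  first are taken in two points with the exception of the extreme ones, which are taken once, while
  the second takes its maximum twice.

  The homotopy is given by a formula made of derivatives of $f$, products, exponentials, the
  composition $L \circ f$ and primitives. Its continuity in the $C^\infty$-topology is obtained by a
  calculus of smooth families: for a space $X$ of parameters, functions $u_x(\theta)$ all of whose
  $\theta$-derivatives are continuous jointly in $x$ and $\theta$. Such families are closed under
  these operations by induction on the order of the derivative, and as the circle is compact, joint
  continuity of the derivatives yields continuity of $x \mapsto u_x$ in the $C^\infty$-topology
  (\<open>continuous_map_circle_map\<close>).
\<close>

section \<open>Smooth families of functions of an angle\<close>

lemma continuous_map_euclidean_mult: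
  fixes f g :: "'x \<Rightarrow> 'a::real_normed_algebra"
  assumes "continuous_map X euclidean f" "continuous_map X euclidean g"
  shows "continuous_map X euclidean (\<lambda>x. f x * g x)"
  using assms by (simp add: continuous_map_atin tendsto_mult)

lemma continuous_map_euclidean_compose_on:
  assumes "continuous_map X euclidean f" "continuous_on S g"
    and "\<And>x. x \<in> topspace X \<Longrightarrow> f x \<in> S"
  shows "continuous_map X euclidean (\<lambda>x. g (f x))"
proof -
  have "continuous_map X (top_of_set S) f"
    using assms by (auto simp: continuous_map_in_subtopology)
  moreover have "continuous_map (top_of_set S) euclidean g"
    using assms by simp
  ultimately show ?thesis
    using continuous_map_compose[of X "top_of_set S" f euclidean g] by (simp add: o_def)
qed

text \<open>
  Families of class $C^n$ in the angle. Continuity is asked for jointly in the parameter and the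
  angle, instead of locally uniformly in the parameter: in this form it is preserved by products and
  compositions without any estimates. The recursion on the derivative, rather than a condition on
  iterated derivatives, is what makes the closure proofs short inductions.
\<close>

primrec cn_family :: "nat \<Rightarrow> 'x topology \<Rightarrow> ('x \<Rightarrow> real \<Rightarrow> complex) \<Rightarrow> bool" where
  "cn_family 0 X u \<longleftrightarrow>
     continuous_map (prod_topology X euclideanreal) euclidean (\<lambda>p. u (fst p) (snd p))"
| "cn_family (Suc n) X u \<longleftrightarrow>
     continuous_map (prod_topology X euclideanreal) euclidean (\<lambda>p. u (fst p) (snd p)) \<and>
     (\<exists>u'. (\<forall>x\<in>topspace X. \<forall>\<theta>. (u x has_vector_derivative u' x \<theta>) (at \<theta>)) \<and>
           cn_family n X u')"

lemma cn_family_continuous: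
  "cn_family n X u \<Longrightarrow>
   continuous_map (prod_topology X euclideanreal) euclidean (\<lambda>p. u (fst p) (snd p))"
  by (cases n) auto

lemma cn_family_SucI:
  assumes "continuous_map (prod_topology X euclideanreal) euclidean (\<lambda>p. u (fst p) (snd p))"
    and "\<And>x \<theta>. x \<in> topspace X \<Longrightarrow> (u x has_vector_derivative u' x \<theta>) (at \<theta>)"
    and "cn_family n X u'"
  shows "cn_family (Suc n) X u"
  using assms by auto

lemma cn_family_SucE:
  assumes "cn_family (Suc n) X u"
  obtains u' where "\<forall>x\<in>topspace X. \<forall>\<theta>. (u x has_vector_derivative u' x \<theta>) (at \<theta>)"
    and "cn_family n X u'"
  using assms by auto

lemma cn_family_Suc_imp: "cn_family (Suc n) X u \<Longrightarrow> cn_family n X u"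
proof (induction n arbitrary: u)
  case (Suc n)
  obtain u' where u': "\<forall>x\<in>topspace X. \<forall>\<theta>. (u x has_vector_derivative u' x \<theta>) (at \<theta>)"
    "cn_family (Suc n) X u'" using Suc.prems by (rule cn_family_SucE)
  show ?case
    by (rule cn_family_SucI[OF cn_family_continuous[OF Suc.prems] u'(1)[rule_format] Suc.IH[OF u'(2)]])
qed simp

lemma cn_family_cong:
  assumes "cn_family n X u" and eq: "\<And>x. x \<in> topspace X \<Longrightarrow> u x = v x"
  shows "cn_family n X v"
proof -
  have c: "continuous_map (prod_topology X euclideanreal) euclidean (\<lambda>p. v (fst p) (snd p))"
    using cn_family_continuous[OF assms(1)] by (rule continuous_map_eq) (auto simp: eq)
  show ?thesis
  proof (cases n)
    case 0
    then show ?thesis using c by simp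
  next
    case (Suc m)
    obtain u' where u': "\<forall>x\<in>topspace X. \<forall>\<theta>. (u x has_vector_derivative u' x \<theta>) (at \<theta>)"
      "cn_family m X u'" using assms(1) unfolding Suc by (rule cn_family_SucE)
    then have "\<And>x \<theta>. x \<in> topspace X \<Longrightarrow> (v x has_vector_derivative u' x \<theta>) (at \<theta>)"
      using eq by metis
    then show ?thesis unfolding Suc using cn_family_SucI[OF c _ u'(2)] by blast
  qed
qed

lemma cn_family_parameter:
  assumes "continuous_map X euclidean a"
  shows "cn_family n X (\<lambda>x \<theta>. a x)"
proof -
  have c: "continuous_map (prod_topology X euclideanreal) euclidean (\<lambda>p. a (fst p))"
    if "continuous_map X euclidean a" for a :: "'a \<Rightarrow> complex"
    using continuous_map_compose[OF continuous_map_fst that] by (simp add: o_def)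
  show ?thesis using assms
  proof (induction n arbitrary: a)
    case 0
    then show ?case using c by simp
  next
    case (Suc n)
    have "cn_family n X (\<lambda>x \<theta>. 0)" using Suc.IH[of "\<lambda>_. 0"] by simp
    from cn_family_SucI[OF c[OF Suc.prems] has_vector_derivative_const this] show ?case .
  qed
qed

lemma cn_family_angle: "cn_family n X (\<lambda>x \<theta>. of_real \<theta>)"
proof -
  have "continuous_map euclideanreal euclidean (of_real :: real \<Rightarrow> complex)"
    by (simp add: continuous_on_of_real_id)
  from continuous_map_compose[OF continuous_map_snd this]
  have c: "continuous_map (prod_topology X euclideanreal) euclidean (\<lambda>p. complex_of_real (snd p))"
    by (simp add: o_def)
  show ?thesis
  proof (cases n)
    case 0
    then show ?thesis using c by simp
  next
    case (Suc m)
    have d: "((\<lambda>\<theta>. complex_of_real \<theta>) has_vector_derivative 1) (at \<theta>)" for \<theta>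
      using has_vector_derivative_of_real[OF DERIV_ident] by simp
    have "cn_family m X (\<lambda>x \<theta>. 1)" by (rule cn_family_parameter) simp
    from cn_family_SucI[OF c d this] show ?thesis using Suc by simp
  qed
qed

lemma cn_family_add:
  assumes "cn_family n X u" "cn_family n X v"
  shows "cn_family n X (\<lambda>x \<theta>. u x \<theta> + v x \<theta>)"
  using assms
proof (induction n arbitrary: u v)
  case 0
  then show ?case by (simp add: continuous_map_add)
next
  case (Suc n)
  obtain u' where u': "\<forall>x\<in>topspace X. \<forall>\<theta>. (u x has_vector_derivative u' x \<theta>) (at \<theta>)"
    "cn_family n X u'" using Suc.prems(1) by (rule cn_family_SucE)
  obtain v' where v': "\<forall>x\<in>topspace X. \<forall>\<theta>. (v x has_vector_derivative v' x \<theta>) (at \<theta>)"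
    "cn_family n X v'" using Suc.prems(2) by (rule cn_family_SucE)
  show ?case
    by (rule cn_family_SucI[OF continuous_map_add[OF Suc.prems[THEN cn_family_continuous]]
          has_vector_derivative_add[OF u'(1)[rule_format] v'(1)[rule_format]] Suc.IH[OF u'(2) v'(2)]])
qed

lemma cn_family_mult:
  assumes "cn_family n X u" "cn_family n X v"
  shows "cn_family n X (\<lambda>x \<theta>. u x \<theta> * v x \<theta>)"
  using assms
proof (induction n arbitrary: u v)
  case 0
  then show ?case by (simp add: continuous_map_euclidean_mult)
next
  case (Suc n)
  obtain u' where u': "\<forall>x\<in>topspace X. \<forall>\<theta>. (u x has_vector_derivative u' x \<theta>) (at \<theta>)"
    "cn_family n X u'" using Suc.prems(1) by (rule cn_family_SucE)
  obtain v' where v': "\<forall>x\<in>topspace X. \<forall>\<theta>. (v x has_vector_derivative v' x \<theta>) (at \<theta>)"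
    "cn_family n X v'" using Suc.prems(2) by (rule cn_family_SucE)
  have "cn_family n X (\<lambda>x \<theta>. u x \<theta> * v' x \<theta> + u' x \<theta> * v x \<theta>)"
    by (intro cn_family_add Suc.IH u' v' Suc.prems[THEN cn_family_Suc_imp])
  from cn_family_SucI[OF continuous_map_euclidean_mult[OF Suc.prems[THEN cn_family_continuous]]
      has_vector_derivative_mult[OF u'(1)[rule_format] v'(1)[rule_format]] this]
  show ?case by simp
qed

lemma cn_family_bounded_linear:
  assumes T: "bounded_linear T" and "cn_family n X u"
  shows "cn_family n X (\<lambda>x \<theta>. T (u x \<theta>))"
proof -
  have "continuous_on UNIV T" using T linear_continuous_on by blast
  then have c: "continuous_map (prod_topology X euclideanreal) euclidean (\<lambda>p. T (u (fst p) (snd p)))"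
    if "cn_family n X u" for n u
    using continuous_map_euclidean_compose_on[OF cn_family_continuous[OF that], of UNIV T] by simp
  show ?thesis using assms(2)
  proof (induction n arbitrary: u)
    case 0
    then show ?case using c[of 0] by simp
  next
    case (Suc n)
    obtain u' where u': "\<forall>x\<in>topspace X. \<forall>\<theta>. (u x has_vector_derivative u' x \<theta>) (at \<theta>)"
      "cn_family n X u'" using Suc.prems by (rule cn_family_SucE)
    show ?case
      by (rule cn_family_SucI[OF c[OF Suc.prems]
            bounded_linear.has_vector_derivative[OF T u'(1)[rule_format]] Suc.IH[OF u'(2)]])
  qed
qed

lemma cn_family_exp:
  assumes "cn_family n X u"
  shows "cn_family n X (\<lambda>x \<theta>. exp (u x \<theta>))"
proof -
  have c: "continuous_map (prod_topology X euclideanreal) euclidean (\<lambda>p. exp (u (fst p) (snd p)))"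
    using continuous_map_euclidean_compose_on[OF cn_family_continuous[OF assms], of UNIV exp]
    by (simp add: continuous_on_exp)
  show ?thesis using assms
  proof (induction n)
    case 0
    then show ?case using c by simp
  next
    case (Suc n)
    obtain u' where u': "\<forall>x\<in>topspace X. \<forall>\<theta>. (u x has_vector_derivative u' x \<theta>) (at \<theta>)"
      "cn_family n X u'" using Suc.prems by (rule cn_family_SucE)
    have d: "((\<lambda>\<theta>. exp (u x \<theta>)) has_vector_derivative u' x \<theta> * exp (u x \<theta>)) (at \<theta>)"
      if "x \<in> topspace X" for x \<theta>
      using field_vector_diff_chain_at[OF u'(1)[rule_format, OF that] DERIV_exp] by (simp add: o_def)
    have "cn_family n X (\<lambda>x \<theta>. u' x \<theta> * exp (u x \<theta>))"
      by (intro cn_family_mult u' Suc.IH Suc.prems[THEN cn_family_Suc_imp])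
    from cn_family_SucI[OF c d this] show ?case by simp
  qed
qed

text \<open>
  Only the parameters are substituted here; a substitution in the angle needs the chain rule, see
  \<open>cn_family_compose_circle\<close>.
\<close>

lemma cn_family_pullback:
  assumes p: "continuous_map Y X p" and "cn_family n X u"
  shows "cn_family n Y (\<lambda>y. u (p y))"
proof -
  have c: "continuous_map (prod_topology Y euclideanreal) euclidean (\<lambda>q. u (p (fst q)) (snd q))"
    if "cn_family n X u" for n u
  proof -
    have "continuous_map (prod_topology Y euclideanreal) X (\<lambda>q. p (fst q))"
      using continuous_map_compose[OF continuous_map_fst p] by (simp add: o_def)
    then have "continuous_map (prod_topology Y euclideanreal) (prod_topology X euclideanreal)
            (\<lambda>q. (p (fst q), snd q))"
      by (rule continuous_map_pairedI[OF _ continuous_map_snd])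
    from continuous_map_compose[OF this cn_family_continuous[OF that]]
    show ?thesis by (simp add: o_def)
  qed
  show ?thesis using assms(2)
  proof (induction n arbitrary: u)
    case 0
    then show ?case using c[of 0] by simp
  next
    case (Suc n)
    obtain u' where u': "\<forall>x\<in>topspace X. \<forall>\<theta>. (u x has_vector_derivative u' x \<theta>) (at \<theta>)"
      "cn_family n X u'" using Suc.prems by (rule cn_family_SucE)
    have "p y \<in> topspace X" if "y \<in> topspace Y" for y
      using p that by (auto simp: continuous_map_def)
    then show ?case
      by (intro cn_family_SucI[OF c[OF Suc.prems] u'(1)[rule_format] Suc.IH[OF u'(2)]])
  qed
qed

section \<open>Uniformity over compact sets and primitives\<close>

lemma continuous_map_to_euclideanI:
  assumes "\<And>x e. \<lbrakk>x \<in> topspace X; 0 < e\<rbrakk> \<Longrightarrow>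
     \<exists>U. openin X U \<and> x \<in> U \<and> (\<forall>y\<in>U. dist (f y) (f x) < e)"
  shows "continuous_map X euclidean f"
  unfolding continuous_map_atin limitin_canonical_iff
proof (intro ballI tendstoI)
  fix x and e :: real assume "x \<in> topspace X" "0 < e"
  then show "\<forall>\<^sub>F y in atin X x. dist (f y) (f x) < e"
    unfolding eventually_atin using assms[of x e] by blast
qed

text \<open>
  The tube lemma, in the form that projections along a compact factor are closed. It turns joint
  continuity into the uniform estimates needed for integrals and for the $C^\infty$-topology.
\<close>

lemma openin_uniformly_small:
  fixes d :: "'x \<times> 'a::topological_space \<Rightarrow> real"
  assumes d: "continuous_map (prod_topology X euclidean) euclideanreal d" and K: "compact K"
  shows "openin X {x \<in> topspace X. \<forall>\<theta>\<in>K. d (x, \<theta>) < \<epsilon>}"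
proof -
  let ?P = "prod_topology X (top_of_set K)"
  let ?C = "{p \<in> topspace ?P. d p \<in> {\<epsilon>..}}"
  have "continuous_map ?P (prod_topology X euclidean) (\<lambda>p. (fst p, snd p))"
    by (intro continuous_map_pairedI continuous_map_fst
        continuous_map_into_fulltopology[OF continuous_map_snd])
  from continuous_map_compose[OF this d] have "continuous_map ?P euclideanreal d"
    by (simp add: o_def)
  then have "closedin ?P ?C"
    by (rule closedin_continuous_map_preimage) simp
  moreover have "closed_map ?P X fst"
    using K by (intro closed_map_fst) (simp add: compact_space_subtopology)
  ultimately have "closedin X (fst ` ?C)"
    by (simp add: closed_map_def)
  then have "openin X (topspace X - fst ` ?C)" by blast
  also have "topspace X - fst ` ?C = {x \<in> topspace X. \<forall>\<theta>\<in>K. d (x, \<theta>) < \<epsilon>}"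
    by (force simp: image_iff not_less)
  finally show ?thesis .
qed

lemma continuous_on_slice:
  assumes "continuous_map (prod_topology X euclidean) euclidean (\<lambda>p. u (fst p) (snd p))"
    and "x \<in> topspace X"
  shows "continuous_on UNIV (u x)"
proof -
  have "continuous_map euclidean (prod_topology X euclidean) (\<lambda>\<theta>. (x, \<theta>))"
    using assms(2) by (intro continuous_map_pairedI) auto
  from continuous_map_compose[OF this assms(1)] show ?thesis by (simp add: o_def)
qed

lemma continuous_map_integral_unit:
  fixes k :: "'z \<Rightarrow> real \<Rightarrow> complex"
  assumes k: "continuous_map (prod_topology Z euclideanreal) euclidean (\<lambda>p. k (fst p) (snd p))"
  shows "continuous_map Z euclidean (\<lambda>z. integral {0..1} (k z))"
proof (rule continuous_map_to_euclideanI)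
  fix z0 and e :: real assume z0: "z0 \<in> topspace Z" and "0 < e"
  have "continuous_map (prod_topology Z euclideanreal) euclidean (\<lambda>p. k z0 (snd p))"
    using continuous_map_compose[OF continuous_map_snd, of euclideanreal euclidean "k z0" Z]
      continuous_on_slice[OF k z0] by (simp add: o_def)
  then have "continuous_map (prod_topology Z euclideanreal) euclideanreal
      (\<lambda>p. norm (k (fst p) (snd p) - k z0 (snd p)))"
    using k by (intro continuous_map_norm continuous_map_diff)
  from openin_uniformly_small[OF this compact_Icc[of 0 1], of "e/2"]
  have "openin Z {z \<in> topspace Z. \<forall>s\<in>{0..1}. norm (k z s - k z0 s) < e / 2}" (is "openin Z ?U")
    by simp
  moreover have "z0 \<in> ?U" using z0 \<open>0 < e\<close> by simp
  moreover have "dist (integral {0..1} (k z)) (integral {0..1} (k z0)) < e" if "z \<in> ?U" for z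
  proof -
    have int: "k y integrable_on {0..1}" if "y \<in> topspace Z" for y
      using continuous_on_slice[OF k that] continuous_on_subset
      by (intro integrable_continuous_real) blast
    have "norm (integral {0..1} (\<lambda>s. k z s - k z0 s)) \<le> e / 2 * (1 - 0)"
      using that z0 int by (intro integral_bound integrable_diff integrable_continuous_real
          continuous_on_diff continuous_on_subset[OF continuous_on_slice[OF k]]) (auto intro: less_imp_le)
    then show ?thesis
      using that z0 int \<open>0 < e\<close> by (simp add: dist_norm integral_diff)
  qed
  ultimately show "\<exists>U. openin Z U \<and> z0 \<in> U \<and>
      (\<forall>z\<in>U. dist (integral {0..1} (k z)) (integral {0..1} (k z0)) < e)"
    by blast
qed

text \<open>
  The primitive that vanishes at $0$. Over the fixed interval $[0, 1]$ the integral covers positive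
  and negative angles at once, and its continuity in a parameter is \<open>continuous_map_integral_unit\<close>.
\<close>

definition antideriv :: "(real \<Rightarrow> complex) \<Rightarrow> real \<Rightarrow> complex" where
  "antideriv u \<theta> = of_real \<theta> * integral {0..1} (\<lambda>s. u (s * \<theta>))"

lemma antideriv_0 [simp]: "antideriv u 0 = 0"
  by (simp add: antideriv_def)

lemma antideriv_eq:
  assumes u: "\<And>z. \<bar>z\<bar> \<le> \<bar>\<theta>\<bar> \<Longrightarrow> (g has_vector_derivative u z) (at z)"
  shows "antideriv u \<theta> = g \<theta> - g 0"
proof -
  have "((\<lambda>s. g (s * \<theta>)) has_vector_derivative \<theta> *\<^sub>R u (s * \<theta>)) (at s within {0..1})"
    if "s \<in> {0..1}" for s
  proof -
    have "((\<lambda>s. s * \<theta>) has_vector_derivative \<theta>) (at s)"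
      by (auto intro!: derivative_eq_intros simp: has_real_derivative_iff_has_vector_derivative[symmetric])
    moreover have "\<bar>s * \<theta>\<bar> \<le> \<bar>\<theta>\<bar>"
      using that mult_left_le_one_le[of "\<bar>\<theta>\<bar>" s] by (simp add: abs_mult)
    ultimately have "((\<lambda>s. g (s * \<theta>)) has_vector_derivative \<theta> *\<^sub>R u (s * \<theta>)) (at s)"
      using vector_diff_chain_at[OF _ u, of "\<lambda>s. s * \<theta>" \<theta> s] by (simp add: o_def)
    then show ?thesis by (rule has_vector_derivative_at_within)
  qed
  then have "((\<lambda>s. \<theta> *\<^sub>R u (s * \<theta>)) has_integral (g (1 * \<theta>) - g (0 * \<theta>))) {0..1}"
    by (intro fundamental_theorem_of_calculus) auto
  from integral_unique[OF this] show ?thesis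
    by (simp add: antideriv_def scaleR_conv_of_real)
qed

lemma antideriv_has_vector_derivative:
  assumes "continuous_on UNIV u"
  shows "(antideriv u has_vector_derivative u \<theta>) (at \<theta>)"
proof -
  define a where "a = \<bar>\<theta>\<bar> + 1"
  obtain g where g0: "\<And>x. x \<in> {-a..a} \<Longrightarrow> (g has_vector_derivative u x) (at x within {-a..a})"
    using antiderivative_continuous[OF continuous_on_subset[OF assms subset_UNIV]] by blast
  then have g: "(g has_vector_derivative u x) (at x)" if "x \<in> {-a<..<a}" for x
    using that g0[of x] at_within_Icc_at[of "-a" x a] by simp
  have "(g has_vector_derivative u \<theta>) (at \<theta>)"
    by (rule g) (auto simp: a_def)
  then have "((\<lambda>y. g y - g 0) has_vector_derivative u \<theta>) (at \<theta>)"
    by (auto intro!: derivative_eq_intros)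
  then show ?thesis
  proof (rule has_vector_derivative_transform_within_open[where S = "{-a<..<a}"])
    show "g y - g 0 = antideriv u y" if "y \<in> {-a<..<a}" for y
      using that by (intro antideriv_eq[symmetric] g) auto
  qed (auto simp: a_def)
qed

lemma has_vector_derivative_shift:
  assumes "(h has_vector_derivative d) (at (b + p))"
  shows "((\<lambda>t. h (t + p)) has_vector_derivative d) (at (b::real))"
proof -
  have "((\<lambda>t. t + p) has_vector_derivative 1) (at b)"
    by (auto intro!: derivative_eq_intros)
  from vector_diff_chain_at[OF this assms] show ?thesis by (simp add: o_def)
qed

text \<open>
  The primitive of a periodic function gains the integral over one period in every period. This
  makes the logarithm of the velocity periodic in degree $0$, and it closes up a curve whose velocity
  has mean $0$.
\<close>

lemma antideriv_periodic:
  assumes u: "continuous_on UNIV u" and per: "\<And>\<theta>. u (\<theta> + p) = u \<theta>"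
  shows "antideriv u (\<theta> + p) = antideriv u \<theta> + antideriv u p"
proof -
  have "((\<lambda>t. antideriv u (t + p) - antideriv u t) has_vector_derivative u (t + p) - u t) (at t within UNIV)" for t
    by (intro has_vector_derivative_diff has_vector_derivative_shift antideriv_has_vector_derivative u)
  then have "((\<lambda>t. antideriv u (t + p) - antideriv u t) has_vector_derivative 0) (at t within UNIV)" for t
    by (simp add: per)
  then obtain k where "\<And>t. t \<in> UNIV \<Longrightarrow> antideriv u (t + p) - antideriv u t = k"
    using has_vector_derivative_zero_constant[OF convex_UNIV,
        of "\<lambda>t. antideriv u (t + p) - antideriv u t"] by blast
  from this[of \<theta>] this[of 0] show ?thesis by (simp add: algebra_simps)
qed

lemma continuous_map_antideriv:
  assumes u: "continuous_map (prod_topology X euclideanreal) euclidean (\<lambda>p. u (fst p) (snd p))"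
  shows "continuous_map (prod_topology X euclideanreal) euclidean (\<lambda>p. antideriv (u (fst p)) (snd p))"
proof -
  let ?P = "prod_topology X euclideanreal"
  have "continuous_map (prod_topology ?P euclideanreal) X (\<lambda>q. fst (fst q))"
    using continuous_map_compose[OF continuous_map_fst continuous_map_fst] by (simp add: o_def)
  moreover have "continuous_map (prod_topology ?P euclideanreal) euclideanreal (\<lambda>q. snd (fst q))"
    using continuous_map_compose[OF continuous_map_fst continuous_map_snd] by (simp add: o_def)
  ultimately have "continuous_map (prod_topology ?P euclideanreal) ?P (\<lambda>q. (fst (fst q), snd q * snd (fst q)))"
    by (intro continuous_map_pairedI continuous_map_real_mult continuous_map_snd)
  from continuous_map_compose[OF this u]
  have "continuous_map (prod_topology ?P euclideanreal) euclidean
      (\<lambda>q. u (fst (fst q)) (snd q * snd (fst q)))" by (simp add: o_def)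
  then have "continuous_map ?P euclidean (\<lambda>p. integral {0..1} (\<lambda>s. u (fst p) (s * snd p)))"
    by (rule continuous_map_integral_unit)
  from continuous_map_euclidean_mult[OF cn_family_continuous[OF cn_family_angle] this]
  show ?thesis unfolding antideriv_def .
qed

lemma cn_family_antideriv:
  assumes "cn_family n X u"
  shows "cn_family (Suc n) X (\<lambda>x. antideriv (u x))"
  by (rule cn_family_SucI[OF continuous_map_antideriv[OF cn_family_continuous[OF assms]]
       antideriv_has_vector_derivative[OF continuous_on_slice[OF cn_family_continuous[OF assms]]] assms])

lemma cn_family_total_integral:
  assumes "cn_family 0 X u"
  shows "continuous_map X euclidean (\<lambda>x. antideriv (u x) a)"
proof -
  have "continuous_map X (prod_topology X euclideanreal) (\<lambda>x. (x, a))"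
    by (intro continuous_map_pairedI) auto
  from continuous_map_compose[OF this continuous_map_antideriv[OF cn_family_continuous[OF assms]]]
  show ?thesis by (simp add: o_def)
qed

section \<open>Families of maps on the circle and the smooth topology\<close>

abbreviation vderiv :: "(real \<Rightarrow> complex) \<Rightarrow> real \<Rightarrow> complex" where
  "vderiv g \<equiv> \<lambda>\<theta>. vector_derivative g (at \<theta>)"

lemma cn_family_vderiv:
  assumes "cn_family (Suc n) X u"
  shows "cn_family n X (\<lambda>x. vderiv (u x))"
proof -
  obtain u' where u': "\<forall>x\<in>topspace X. \<forall>\<theta>. (u x has_vector_derivative u' x \<theta>) (at \<theta>)"
    "cn_family n X u'" using assms by (rule cn_family_SucE)
  show ?thesis
    using u'(2) by (rule cn_family_cong) (use u'(1) in \<open>auto intro!: ext vector_derivative_at[symmetric]\<close>)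
qed

lemma cn_family_vderiv_iterate:
  "cn_family (k + n) X u \<Longrightarrow> cn_family n X (\<lambda>x. (vderiv ^^ k) (u x))"
proof (induction k arbitrary: n)
  case (Suc k)
  then show ?case using cn_family_vderiv[OF Suc.IH[of "Suc n"]] by simp
qed simp

lemma cn_family_differentiable:
  assumes "cn_family (Suc n) X u" "x \<in> topspace X"
  shows "u x differentiable (at \<theta>)"
  using assms by (metis cn_family_SucE differentiableI_vector)

lemma circle_deriv_has_vector_derivative:
  assumes "c \<in> smooth_maps"
  shows "(circle_deriv k c has_vector_derivative circle_deriv (Suc k) c \<theta>) (at \<theta>)"
proof -
  have "circle_deriv k c differentiable (at \<theta>)"
    using assms by (simp add: smooth_maps_def)
  then show ?thesis
    by (simp add: vector_derivative_works circle_deriv_def)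
qed

lemma vderiv_periodic:
  assumes "\<And>\<theta>. h (\<theta> + p) = h \<theta>" "\<And>\<theta>. h differentiable (at \<theta>)"
  shows "vderiv h (\<theta> + p) = vderiv h \<theta>"
proof -
  have "((\<lambda>t. h (t + p)) has_vector_derivative vderiv h (\<theta> + p)) (at \<theta>)"
    using assms(2) by (intro has_vector_derivative_shift) (simp add: vector_derivative_works[symmetric])
  then show ?thesis using assms(1) by (simp add: vector_derivative_at)
qed

lemma cis_periodic: "cis (\<theta> + 2 * pi) = cis \<theta>"
  by (simp add: cis.ctr)

lemma circle_deriv_periodic:
  assumes "c \<in> smooth_maps"
  shows "circle_deriv k c (\<theta> + 2 * pi) = circle_deriv k c \<theta>"
proof (induction k arbitrary: \<theta>)
  case 0
  then show ?case by (simp add: circle_deriv_def cis_periodic)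
next
  case (Suc k)
  have "circle_deriv k c differentiable (at \<theta>)" for \<theta>
    using assms by (simp add: smooth_maps_def)
  from vderiv_periodic[OF Suc this] show ?case by (simp add: circle_deriv_def)
qed


lemma periodic_int_shift:
  assumes "\<And>\<theta>. h (\<theta> + 2 * pi) = h \<theta>"
  shows "h (\<theta> + 2 * pi * real_of_int k) = h \<theta>"
proof (induction k rule: int_induct[where k = 0])
  case (step1 i)
  then show ?case using assms[of "\<theta> + 2 * pi * real_of_int i"] by (simp add: algebra_simps)
next
  case (step2 i)
  then show ?case using assms[of "\<theta> + 2 * pi * real_of_int (i - 1)"] by (simp add: algebra_simps)
qed simp

lemma periodic_cong_cis:
  assumes "\<And>\<theta>. h (\<theta> + 2 * pi) = h \<theta>" and "cis a = cis b"
  shows "h a = h b"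
proof -
  have "exp (\<i> * of_real a) = exp (\<i> * of_real b)"
    using assms(2) by (simp add: cis_conv_exp)
  then obtain k :: int where
    "\<i> * complex_of_real a = \<i> * of_real b + of_real (real_of_int (2 * k) * pi) * \<i>"
    unfolding exp_eq by blast
  then have "Im (\<i> * complex_of_real a) = Im (\<i> * of_real b + of_real (real_of_int (2 * k) * pi) * \<i>)"
    by (rule arg_cong)
  then have "a = b + 2 * pi * real_of_int k" by simp
  then show ?thesis using periodic_int_shift[of h, OF assms(1)] by simp
qed

lemma cis_Arg_unit: "norm z = 1 \<Longrightarrow> cis (Arg z) = z"
  using rcis_cmod_Arg[of z] by (simp add: rcis_def)

lemma periodic_cis_Arg:
  assumes "\<And>\<theta>. h (\<theta> + 2 * pi) = h \<theta>"
  shows "h (Arg (cis \<theta>)) = h \<theta>"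
  using assms by (rule periodic_cong_cis) (simp add: cis_Arg_unit)

lemma periodic_Arg2pi_cis:
  assumes "\<And>\<theta>. h (\<theta> + 2 * pi) = h \<theta>"
  shows "h (Arg2pi (cis \<theta>)) = h \<theta>"
  using assms by (rule periodic_cong_cis) (metis Arg2pi_eq cis_conv_exp norm_cis mult_1 of_real_1)

text \<open>
  This is how the calculus of families is fed: a point of the function space is itself a parameter,
  on which its derivatives depend continuously.
\<close>

lemma continuous_map_circle_deriv:
  "continuous_map (prod_topology Cinf_topology euclideanreal) euclidean
     (\<lambda>p. circle_deriv k (fst p) (snd p))"
proof (rule continuous_map_to_euclideanI)
  fix p and e :: real
  assume "p \<in> topspace (prod_topology Cinf_topology euclideanreal)" and "0 < e"
  then have c: "fst p \<in> smooth_maps" by auto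
  define c \<theta> where "c = fst p" and "\<theta> = snd p"
  let ?U = "{d \<in> smooth_maps. \<forall>\<theta>. norm (circle_deriv k d \<theta> - circle_deriv k c \<theta>) < e / 2}"
  let ?V = "{t. dist (circle_deriv k c t) (circle_deriv k c \<theta>) < e / 2}"
  have "openin Cinf_topology ?U"
    unfolding Cinf_topology_def openin_topology_generated_by_iff
    by (rule generate_topology_on.Basis)
       (use c \<open>0 < e\<close> in \<open>auto simp: c_def intro!: exI[of _ "fst p"] exI[of _ k] exI[of _ "e / 2"]\<close>)
  moreover have "open ?V"
  proof (rule open_Collect_less)
    have "continuous_on UNIV (circle_deriv k c)"
      using circle_deriv_has_vector_derivative c
      by (metis c_def continuous_at_imp_continuous_on has_vector_derivative_continuous)
    then show "continuous_on UNIV (\<lambda>t. dist (circle_deriv k c t) (circle_deriv k c \<theta>))"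
      by (intro continuous_intros)
  qed simp
  ultimately have "openin (prod_topology Cinf_topology euclideanreal) (?U \<times> ?V)"
    by (simp add: openin_prod_Times_iff)
  moreover have "p \<in> ?U \<times> ?V"
    using c \<open>0 < e\<close> by (simp add: c_def \<theta>_def mem_Times_iff)
  moreover have "dist (circle_deriv k (fst q) (snd q)) (circle_deriv k (fst p) (snd p)) < e"
    if "q \<in> ?U \<times> ?V" for q
  proof -
    have "dist (circle_deriv k (fst q) (snd q)) (circle_deriv k c (snd q)) < e / 2"
      and "dist (circle_deriv k c (snd q)) (circle_deriv k c \<theta>) < e / 2"
      using that by (auto simp: mem_Times_iff dist_norm)
    then show ?thesis
      using dist_triangle[of "circle_deriv k (fst q) (snd q)" "circle_deriv k c \<theta>"
          "circle_deriv k c (snd q)"]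
      unfolding c_def \<theta>_def by linarith
  qed
  ultimately show "\<exists>U. openin (prod_topology Cinf_topology euclideanreal) U \<and> p \<in> U \<and>
      (\<forall>q\<in>U. dist (circle_deriv k (fst q) (snd q)) (circle_deriv k (fst p) (snd p)) < e)"
    by blast
qed

lemma cn_family_circle_deriv: "cn_family n Cinf_topology (\<lambda>c. circle_deriv k c)"
proof (induction n arbitrary: k)
  case 0
  then show ?case using continuous_map_circle_deriv by simp
next
  case (Suc n)
  show ?case
    by (rule cn_family_SucI[OF continuous_map_circle_deriv circle_deriv_has_vector_derivative Suc])
       simp
qed

text \<open>
  The inverse of $c \mapsto (\theta \mapsto c(e^{i\theta}))$ on periodic functions, for which any
  branch of the angle gives the same value.
\<close>

definition circle_map :: "(real \<Rightarrow> complex) \<Rightarrow> complex \<Rightarrow> complex" where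
  "circle_map h = restrict (\<lambda>z. h (Arg z)) circle"

lemma circle_map_cis:
  assumes "\<And>\<theta>. h (\<theta> + 2 * pi) = h \<theta>"
  shows "circle_map h (cis \<theta>) = h \<theta>"
  using periodic_cis_Arg[of h, OF assms] by (simp add: circle_map_def)

lemma circle_deriv_circle_map:
  assumes "\<And>\<theta>. h (\<theta> + 2 * pi) = h \<theta>"
  shows "circle_deriv k (circle_map h) = (vderiv ^^ k) h"
  using circle_map_cis[of h, OF assms] by (simp add: circle_deriv_def)

lemma circle_map_eqI:
  assumes "c \<in> extensional circle" "\<And>\<theta>. h \<theta> = c (cis \<theta>)"
  shows "circle_map h = c"
proof
  fix z show "circle_map h z = c z"
    using assms by (auto simp: circle_map_def cis_Arg_unit extensional_def)
qed

lemma circle_map_smooth: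
  assumes u: "\<And>n. cn_family n X u" and x: "x \<in> topspace X"
    and per: "\<And>\<theta>. u x (\<theta> + 2 * pi) = u x \<theta>"
  shows "circle_map (u x) \<in> smooth_maps"
proof -
  have "(vderiv ^^ k) (u x) differentiable (at \<theta>)" for k \<theta>
    using cn_family_differentiable[OF cn_family_vderiv_iterate[OF u] x] .
  moreover have "circle_map (u x) \<in> extensional circle"
    by (simp add: circle_map_def)
  ultimately show ?thesis
    using circle_deriv_circle_map[of "u x", OF per] by (simp add: smooth_maps_def)
qed

text \<open>
  A subbasic open set asks for an estimate at all angles. By periodicity the angles in $[0, 2\pi]$
  are enough, and this interval is compact.
\<close>

lemma continuous_map_circle_map:
  assumes u: "\<And>n. cn_family n X u"
    and per: "\<And>x \<theta>. x \<in> topspace X \<Longrightarrow> u x (\<theta> + 2 * pi) = u x \<theta>"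
  shows "continuous_map X Cinf_topology (\<lambda>x. circle_map (u x))"
proof -
  have smooth: "circle_map (u x) \<in> smooth_maps" if "x \<in> topspace X" for x
    using u that per[OF that] by (rule circle_map_smooth)
  show ?thesis
    unfolding Cinf_topology_def
  proof (rule continuous_on_generated_topo, safe)
    fix c k and \<epsilon> :: real assume c: "c \<in> smooth_maps" and "0 < \<epsilon>"
    let ?d = "\<lambda>p. norm ((vderiv ^^ k) (u (fst p)) (snd p) - circle_deriv k c (snd p))"
    have "cn_family 0 X (\<lambda>x. circle_deriv k c)"
      using cn_family_pullback[OF _ cn_family_circle_deriv, of X "\<lambda>_. c" 0 k] c by simp
    then have "continuous_map (prod_topology X euclideanreal) euclideanreal ?d"
      using cn_family_continuous[OF cn_family_vderiv_iterate[OF u[of "k + 0"]]]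
      by (intro continuous_map_norm continuous_map_diff) simp_all
    from openin_uniformly_small[OF this compact_Icc[of 0 "2*pi"], of \<epsilon>]
    have "openin X {x \<in> topspace X. \<forall>\<theta>\<in>{0..2*pi}. ?d (x, \<theta>) < \<epsilon>}" .
    moreover have "(\<lambda>x. circle_map (u x)) -`
        {d \<in> smooth_maps. \<forall>\<theta>. norm (circle_deriv k d \<theta> - circle_deriv k c \<theta>) < \<epsilon>} \<inter> topspace X =
        {x \<in> topspace X. \<forall>\<theta>\<in>{0..2*pi}. ?d (x, \<theta>) < \<epsilon>}"
    proof -
      have "(\<forall>\<theta>. ?d (x, \<theta>) < \<epsilon>) \<longleftrightarrow> (\<forall>\<theta>\<in>{0..2*pi}. ?d (x, \<theta>) < \<epsilon>)" if x: "x \<in> topspace X" for x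
      proof -
        have "?d (x, \<theta> + 2 * pi) = ?d (x, \<theta>)" for \<theta>
          using circle_deriv_periodic[OF smooth[OF x], of k \<theta>] circle_deriv_periodic[OF c, of k \<theta>]
            circle_deriv_circle_map[of "u x", OF per[OF x]] by simp
        from periodic_Arg2pi_cis[of "\<lambda>\<theta>. ?d (x, \<theta>)", OF this]
        show ?thesis using Arg2pi_ge_0 Arg2pi_lt_2pi by (metis atLeastAtMost_iff less_imp_le)
      qed
      note iff = this
      show ?thesis
      proof (rule set_eqI)
        fix x show "x \<in> (\<lambda>x. circle_map (u x)) -`
            {d \<in> smooth_maps. \<forall>\<theta>. norm (circle_deriv k d \<theta> - circle_deriv k c \<theta>) < \<epsilon>} \<inter> topspace X
          \<longleftrightarrow> x \<in> {x \<in> topspace X. \<forall>\<theta>\<in>{0..2*pi}. ?d (x, \<theta>) < \<epsilon>}"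
          using smooth[of x] circle_deriv_circle_map[of "u x", OF per] iff[of x]
          by (cases "x \<in> topspace X") simp_all
      qed
    qed
    ultimately show "openin X ((\<lambda>x. circle_map (u x)) -`
        {d \<in> smooth_maps. \<forall>\<theta>. norm (circle_deriv k d \<theta> - circle_deriv k c \<theta>) < \<epsilon>} \<inter> topspace X)"
      by simp
  next
    fix x assume x: "x \<in> topspace X"
    have "circle_map (u x) \<in> topspace Cinf_topology"
      using smooth[OF x] by simp
    then show "circle_map (u x) \<in> \<Union>{{d \<in> smooth_maps. \<forall>\<theta>. norm (circle_deriv k d \<theta> - circle_deriv k c \<theta>) < \<epsilon>} |
        c k \<epsilon>. c \<in> smooth_maps \<and> 0 < \<epsilon>}"
      unfolding Cinf_topology_def topology_generated_by_topspace .
  qed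
qed

text \<open>
  An angle for all points of the circle that depends differentiably on $z$ near \<open>cis a\<close>. The
  equation itself holds even where the logarithm is discontinuous, so that continuity and
  differentiability at \<open>cis a\<close> follow without restricting to a neighbourhood.
\<close>

lemma circle_angle:
  assumes "norm z = 1"
  shows "z = cis (a + Im (Ln (z / cis a)))"
proof -
  define w where "w = z / cis a"
  have "w \<noteq> 0" "norm w = 1" using assms by (auto simp: w_def norm_divide)
  then have "cis (Im (Ln w)) = w"
    using exp_Ln[of w] exp_eq_polar[of "Ln w"] by (simp add: Re_Ln)
  then show ?thesis by (simp add: w_def cis_mult[symmetric])
qed

lemma continuous_on_circle:
  assumes "continuous_on UNIV (\<lambda>\<theta>. g (cis \<theta>))"
  shows "continuous_on circle g"
proof (clarsimp simp: continuous_on_eq_continuous_within)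
  fix z0 :: complex assume z0: "norm z0 = 1"
  define a where "a = Arg z0"
  have a: "cis a = z0" using z0 by (simp add: a_def cis_Arg_unit)
  have "z0 \<noteq> 0" using z0 by auto
  then have "isCont (\<lambda>z. z / z0) z0" by (intro continuous_intros)
  then have "isCont (\<lambda>z. Ln (z / z0)) z0"
    by (rule isCont_o2) (simp add: \<open>z0 \<noteq> 0\<close> continuous_at_Ln)
  then have "isCont (\<lambda>z. a + Im (Ln (z / cis a))) z0"
    unfolding a by (intro continuous_add continuous_const isCont_Im)
  moreover have "isCont (\<lambda>\<theta>. g (cis \<theta>)) t" for t
    using assms by (simp add: continuous_on_eq_continuous_at)
  ultimately have "isCont (\<lambda>z. g (cis (a + Im (Ln (z / cis a))))) z0"
    by (rule isCont_o2)
  then have "continuous (at z0 within circle) (\<lambda>z. g (cis (a + Im (Ln (z / cis a)))))"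
    by (rule continuous_at_imp_continuous_at_within)
  then show "continuous (at z0 within circle) g"
    by (rule continuous_transform_within[OF _ zero_less_one])
       (use z0 circle_angle[of _ a] in \<open>auto simp: circle_angle[symmetric]\<close>)
qed

text \<open>
  Near $\theta$ the curve $F$ is \<open>cis \<circ> \<phi>\<close> with an angle $\phi$ whose derivative at $\theta$ is $r$,
  so this is the chain rule for $\theta \mapsto g(e^{i\theta})$ and $\phi$.
\<close>

lemma circle_chain_rule:
  fixes F :: "real \<Rightarrow> complex"
  assumes F: "\<And>t. norm (F t) = 1"
    and F': "(F has_vector_derivative of_real r * (\<i> * F \<theta>)) (at \<theta>)"
    and g: "\<And>t. ((\<lambda>t. g (cis t)) has_vector_derivative g' (cis t)) (at t)"
  shows "((\<lambda>t. g (F t)) has_vector_derivative of_real r * g' (F \<theta>)) (at \<theta>)"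
proof -
  define a where "a = Arg (F \<theta>)"
  define \<phi> where "\<phi> t = a + Im (Ln (F t / F \<theta>))" for t
  have a: "cis a = F \<theta>" using F[of \<theta>] by (simp add: a_def cis_Arg_unit)
  have nz: "F \<theta> \<noteq> 0" using F[of \<theta>] by auto
  have lift: "F t = cis (\<phi> t)" for t
    using circle_angle[OF F, of t a] by (simp add: \<phi>_def a)
  have "((\<lambda>t. F t / F \<theta>) has_vector_derivative of_real r * \<i>) (at \<theta>)"
    using has_vector_derivative_divide[OF F', of "F \<theta>"] nz by simp
  from field_vector_diff_chain_at[OF this, of Ln 1] 
  have "((\<lambda>t. Ln (F t / F \<theta>)) has_vector_derivative of_real r * \<i>) (at \<theta>)"
    using has_field_derivative_Ln[of 1] nz by (simp add: o_def)
  from bounded_linear.has_vector_derivative[OF bounded_linear_Im this]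
  have "(\<phi> has_vector_derivative r) (at \<theta>)"
    unfolding \<phi>_def by (auto intro!: derivative_eq_intros)
  from vector_diff_chain_at[OF this g]
  show ?thesis by (simp add: o_def lift scaleR_conv_of_real)
qed

text \<open>
  The function $g$ lives on the circle and is fixed, so its regularity is expressed by a family over
  an unrelated nonempty space $Y$. The induction works because the derivative is $r \cdot (g' \circ F)$,
  where $g'$ is again a function on the circle.
\<close>

lemma cn_family_compose_circle:
  assumes g: "cn_family n Y (\<lambda>_ \<theta>. g (cis \<theta>))" and Y: "y \<in> topspace Y"
    and F: "\<And>n. cn_family n X F" "\<And>x \<theta>. x \<in> topspace X \<Longrightarrow> norm (F x \<theta>) = 1"
    and r: "\<And>n. cn_family n X (\<lambda>x \<theta>. of_real (r x \<theta>))"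
    and F': "\<And>x \<theta>. x \<in> topspace X \<Longrightarrow>
               (F x has_vector_derivative of_real (r x \<theta>) * (\<i> * F x \<theta>)) (at \<theta>)"
  shows "cn_family n X (\<lambda>x \<theta>. g (F x \<theta>))"
proof -
  have F_circle: "F (fst p) (snd p) \<in> circle" if "p \<in> topspace (prod_topology X euclideanreal)" for p
    using F(2) that by auto
  show ?thesis using g
  proof (induction n arbitrary: g)
    case 0
    then have "continuous_on circle g"
      using continuous_on_slice[OF cn_family_continuous[OF 0] Y] by (intro continuous_on_circle)
    then show ?case
      using continuous_map_euclidean_compose_on[OF cn_family_continuous[OF F(1)] _ F_circle] by simp
  next
    case (Suc n)
    \<comment> \<open>The derivative with respect to the angle is periodic, hence a function on the circle again.\<close>
    define g' where "g' z = vderiv (\<lambda>\<theta>. g (cis \<theta>)) (Arg z)" for z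
    have diff: "(\<lambda>\<theta>. g (cis \<theta>)) differentiable (at \<theta>)" for \<theta>
      using cn_family_differentiable[OF Suc.prems Y] .
    have g'_cis: "g' (cis \<theta>) = vderiv (\<lambda>\<theta>. g (cis \<theta>)) \<theta>" for \<theta>
      unfolding g'_def
      by (rule periodic_cis_Arg[of "vderiv (\<lambda>\<theta>. g (cis \<theta>))"], rule vderiv_periodic)
         (simp_all add: cis_periodic diff)
    have g': "((\<lambda>\<theta>. g (cis \<theta>)) has_vector_derivative g' (cis \<theta>)) (at \<theta>)" for \<theta>
      using diff by (simp add: g'_cis vector_derivative_works)
    have "continuous_on circle g"
      using continuous_on_slice[OF cn_family_continuous[OF Suc.prems] Y] by (intro continuous_on_circle)
    then have c: "continuous_map (prod_topology X euclideanreal) euclidean (\<lambda>p. g (F (fst p) (snd p)))"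
      using continuous_map_euclidean_compose_on[OF cn_family_continuous[OF F(1)] _ F_circle] by simp
    have d: "((\<lambda>\<theta>. g (F x \<theta>)) has_vector_derivative of_real (r x \<theta>) * g' (F x \<theta>)) (at \<theta>)"
      if "x \<in> topspace X" for x \<theta>
      using F(2)[OF that] F'[OF that] g' by (rule circle_chain_rule)
    have "cn_family n Y (\<lambda>_ \<theta>. g' (cis \<theta>))"
      using cn_family_vderiv[OF Suc.prems] by (simp add: g'_cis)
    from cn_family_SucI[OF c d cn_family_mult[OF r Suc.IH[OF this]]]
    show ?case by simp
  qed
qed

section \<open>The logarithm of the velocity of an immersion of degree 0\<close>

text \<open>
  The primitive $L$ of $c''/c'$ with $e^{L(0)} = c'(0)$ is a logarithm of $c'$, and its increment over
  one period is $2\pi i$ times the rotation degree.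
\<close>

lemma Imm0_smooth_logarithm:
  assumes c: "c \<in> Imm0"
  obtains L where "\<And>\<theta>. circle_deriv 1 c \<theta> = exp (L \<theta>)" "\<And>\<theta>. L (\<theta> + 2 * pi) = L \<theta>"
    "\<And>n. cn_family n X (\<lambda>_. L)"
proof -
  have smooth: "c \<in> smooth_maps" and nz: "\<And>\<theta>. circle_deriv 1 c \<theta> \<noteq> 0"
    and deg: "rotation_degree c = 0"
    using c by (auto simp: Imm0_def immersions_def)
  define v where "v = circle_deriv 1 c"
  define v' where "v' = circle_deriv 2 c"
  have v': "(v has_vector_derivative v' \<theta>) (at \<theta>)" for \<theta>
    using circle_deriv_has_vector_derivative[OF smooth, of 1] by (simp add: v_def v'_def numeral_2_eq_2)
  have nz: "v \<theta> \<noteq> 0" for \<theta> using nz by (simp add: v_def)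
  have cont: "continuous_on UNIV (circle_deriv k c)" for k
    using circle_deriv_has_vector_derivative[OF smooth]
    by (intro continuous_at_imp_continuous_on ballI has_vector_derivative_continuous)
  have cont_quot: "continuous_on UNIV (\<lambda>\<theta>. v' \<theta> / v \<theta>)"
    using nz by (intro continuous_on_divide) (auto simp: v_def v'_def cont)
  define L where "L \<theta> = Ln (v 0) + antideriv (\<lambda>\<theta>. v' \<theta> / v \<theta>) \<theta>" for \<theta>
  have L': "(L has_vector_derivative v' \<theta> / v \<theta>) (at \<theta>)" for \<theta>
    unfolding L_def using antideriv_has_vector_derivative[OF cont_quot]
    by (auto intro!: derivative_eq_intros)
  have "((\<lambda>\<theta>. exp (- L \<theta>) * (v \<theta> - 0)) has_vector_derivative 0) (at \<theta> within UNIV)" for \<theta>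
    by (rule exp_fg) (use v' L' nz in auto)
  then obtain k where k: "\<And>\<theta>. \<theta> \<in> UNIV \<Longrightarrow> exp (- L \<theta>) * (v \<theta> - 0) = k"
    using has_vector_derivative_zero_constant[OF convex_UNIV, of "\<lambda>\<theta>. exp (- L \<theta>) * (v \<theta> - 0)"] by blast
  have "k = 1" using k[of 0] nz[of 0] by (simp add: L_def exp_minus)
  with k have exp_L: "v \<theta> = exp (L \<theta>)" for \<theta>
    by (simp add: exp_minus field_simps)
  have L_cont: "continuous_on UNIV L"
    using L' by (intro continuous_at_imp_continuous_on ballI has_vector_derivative_continuous)
  have "path (\<lambda>t. L (2 * pi * t))"
    unfolding path_def by (intro continuous_on_compose2[OF L_cont] continuous_intros) auto
  from winding_number_compose_exp[OF this]
  have "rotation_degree c = (L (2 * pi) - L 0) / (2 * of_real pi * \<i>)"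
    unfolding rotation_degree_def v_def[symmetric]
    by (simp add: exp_L o_def pathfinish_def pathstart_def)
  then have "antideriv (\<lambda>\<theta>. v' \<theta> / v \<theta>) (2 * pi) = 0"
    using deg by (simp add: L_def)
  then have L_per: "L (\<theta> + 2 * pi) = L \<theta>" for \<theta>
    using antideriv_periodic[OF cont_quot, of "2 * pi" \<theta>]
      circle_deriv_periodic[OF smooth, of 1] circle_deriv_periodic[OF smooth, of 2]
    by (simp add: L_def v_def v'_def)
  have c0: "continuous_map (prod_topology X euclideanreal) euclidean (\<lambda>p. L (snd p))"
    using continuous_map_compose[OF continuous_map_snd, of euclideanreal euclidean L X] L_cont
    by (simp add: o_def)
  have "cn_family n X (\<lambda>_. L)" for n
  proof (induction n)
    case 0
    then show ?case using c0 by simp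
  next
    case (Suc n)
    \<comment> \<open>Written as $L' = c'' e^{-L}$, the differential equation for $L$ gains one derivative at each
      step and needs no division of families.\<close>
    have "cn_family n X (\<lambda>_. v')"
      using cn_family_pullback[OF _ cn_family_circle_deriv, of X "\<lambda>_. c"] smooth by (simp add: v'_def)
    moreover have "cn_family n X (\<lambda>_ \<theta>. exp (- 1 * L \<theta>))"
      by (intro cn_family_exp cn_family_mult Suc cn_family_parameter) simp
    ultimately have "cn_family n X (\<lambda>_ \<theta>. v' \<theta> * exp (- 1 * L \<theta>))"
      by (rule cn_family_mult)
    moreover have "v' \<theta> * exp (- 1 * L \<theta>) = v' \<theta> / v \<theta>" for \<theta>
      by (simp add: exp_L exp_minus field_simps)
    ultimately have "cn_family n X (\<lambda>_ \<theta>. v' \<theta> / v \<theta>)" by simp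
    from cn_family_SucI[OF c0 L' this] show ?case .
  qed
  then show thesis using that[of L] exp_L L_per by (simp add: v_def)
qed

section \<open>Closed curves with prescribed speed and tangent angle\<close>

lemma integral_unit_pos:
  fixes a :: "real \<Rightarrow> real"
  assumes "continuous_on {0..1} a" "\<And>s. s \<in> {0..1} \<Longrightarrow> 0 < a s"
  shows "0 < integral {0..1} a"
proof -
  have nonneg: "0 \<le> a s" if "s \<in> {0..1}" for s using assms(2)[OF that] by simp
  have "integral {0..1} a \<noteq> 0"
    using integral_eq_0_iff[OF assms(1) zero_less_one nonneg] assms(2)[of 0] by auto
  moreover have "0 \<le> integral {0..1} a"
    using nonneg by (intro integral_nonneg integrable_continuous_real assms(1))
  ultimately show ?thesis by simp
qed

text \<open>
  The equality case of the triangle inequality for integrals: rotate the integral by $u$ to the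
  positive axis; then $a (1 - \operatorname{Re}(u e))$ is nonnegative with integral at most $0$.
\<close>

lemma weighted_mean_unimodular:
  fixes a :: "real \<Rightarrow> real" and e :: "real \<Rightarrow> complex"
  assumes a: "continuous_on {0..1} a" "\<And>s. s \<in> {0..1} \<Longrightarrow> 0 < a s"
    and e: "continuous_on {0..1} e" "\<And>s. s \<in> {0..1} \<Longrightarrow> norm (e s) = 1"
    and ge: "integral {0..1} a \<le> norm (integral {0..1} (\<lambda>s. of_real (a s) * e s))"
    and s: "s \<in> {0..1}"
  shows "e s = e 0"
proof -
  define \<mu> where "\<mu> = integral {0..1} (\<lambda>s. of_real (a s) * e s)"
  define u where "u = cnj (sgn \<mu>)"
  have "0 < integral {0..1} a" using a by (rule integral_unit_pos)
  then have "\<mu> \<noteq> 0" using ge by (auto simp: \<mu>_def)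
  then have u1: "norm u = 1" by (simp add: u_def norm_sgn)
  have "u * \<mu> = of_real (inverse (norm \<mu>)) * (\<mu> * cnj \<mu>)"
    by (simp add: u_def sgn_div_norm scaleR_conv_of_real)
  also have "\<dots> = of_real (norm \<mu>)"
    using \<open>\<mu> \<noteq> 0\<close> by (simp add: complex_norm_square[symmetric] power2_eq_square)
  finally have u: "norm u = 1" "u * \<mu> = of_real (norm \<mu>)" using u1 by simp_all
  let ?d = "\<lambda>s. a s * (1 - Re (u * e s))"
  have cont: "continuous_on {0..1} ?d"
    by (intro continuous_intros a e)
  have nonneg: "0 \<le> ?d s" if "s \<in> {0..1}" for s
  proof -
    have "Re (u * e s) \<le> norm (u * e s)" by (rule complex_Re_le_cmod)
    then show ?thesis using a(2)[OF that] e(2)[OF that] u(1) by (simp add: norm_mult)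
  qed
  have int: "(\<lambda>s. of_real (a s) * e s) integrable_on {0..1}"
    by (intro integrable_continuous_real continuous_intros a e)
  have "((\<lambda>s. Re (u * (of_real (a s) * e s))) has_integral Re (u * \<mu>)) {0..1}"
    using int unfolding \<mu>_def
    by (intro has_integral_Re has_integral_mult_right integrable_integral)
  moreover have "(a has_integral integral {0..1} a) {0..1}"
    by (intro integrable_integral integrable_continuous_real a)
  ultimately have "((\<lambda>s. a s - Re (u * (of_real (a s) * e s))) has_integral
      integral {0..1} a - Re (u * \<mu>)) {0..1}"
    by (rule has_integral_diff[rotated])
  moreover have "(\<lambda>s. a s - Re (u * (of_real (a s) * e s))) = ?d"
    by (auto simp: fun_eq_iff algebra_simps)
  ultimately have "integral {0..1} ?d = integral {0..1} a - Re (u * \<mu>)"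
    by (simp add: integral_unique)
  moreover have "Re (u * \<mu>) = norm \<mu>" by (simp only: u(2) Re_complex_of_real)
  ultimately have "integral {0..1} ?d \<le> 0" using ge by (simp only: \<mu>_def)
  moreover have "integral {0..1} ?d \<ge> 0"
    using nonneg by (intro integral_nonneg integrable_continuous_real cont)
  ultimately have "\<forall>s\<in>{0..1}. ?d s = 0"
    using integral_eq_0_iff[OF cont zero_less_one nonneg] by simp
  then have "Re (u * e s) = 1" if "s \<in> {0..1}" for s
    using a(2)[OF that] that by force
  then have "u * e s = 1" if "s \<in> {0..1}" for s
    using that cmod_eq_Re[of "u * e s"] e(2)[OF that] u(1)
      complex_eq_iff[of "u * e s" 1] cmod_power2[of "u * e s"] by (auto simp: norm_mult)
  then have "u * e s = u * e 0" using s by simp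
  then show ?thesis using u(1) by auto
qed

text \<open>
  A primitive that vanishes at $0$, taken at $2\pi$, is the integral over one period: this is the
  average of the unit vectors $e^{i\phi}$ with weight $w$.
\<close>

definition mean_direction :: "(real \<Rightarrow> real) \<Rightarrow> (real \<Rightarrow> real) \<Rightarrow> complex" where
  "mean_direction w \<phi> =
     antideriv (\<lambda>\<theta>. of_real (w \<theta>) * cis (\<phi> \<theta>)) (2 * pi) / antideriv (\<lambda>\<theta>. of_real (w \<theta>)) (2 * pi)"

text \<open>
  The curve through $b$ with velocity $w (e^{i\phi} - m)$. Subtracting the mean direction $m$
  makes the velocity integrate to $0$ over a period; $m$ vanishes if $w e^{i\phi}$ does so already.
\<close>

definition closed_curve :: "complex \<Rightarrow> (real \<Rightarrow> real) \<Rightarrow> (real \<Rightarrow> real) \<Rightarrow> real \<Rightarrow> complex" where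
  "closed_curve b w \<phi> \<theta> =
     b + antideriv (\<lambda>s. of_real (w s) * (cis (\<phi> s) - mean_direction w \<phi>)) \<theta>"

lemma antideriv_weight_pos:
  assumes "continuous_on UNIV w" "\<And>\<theta>. 0 < w \<theta>"
  shows "antideriv (\<lambda>\<theta>. of_real (w \<theta>)) (2 * pi) = of_real (2 * pi * integral {0..1} (\<lambda>s. w (s * (2 * pi))))"
    and "0 < integral {0..1} (\<lambda>s. w (s * (2 * pi)))"
proof -
  have c: "continuous_on {0..1} (\<lambda>s. w (s * (2 * pi)))"
    by (intro continuous_on_compose2[OF assms(1)] continuous_intros) auto
  have "((\<lambda>s. complex_of_real (w (s * (2 * pi)))) has_integral
      of_real (integral {0..1} (\<lambda>s. w (s * (2 * pi))))) {0..1}"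
    by (intro has_integral_of_real integrable_integral integrable_continuous_real c)
  from integral_unique[OF this]
  show "antideriv (\<lambda>\<theta>. of_real (w \<theta>)) (2 * pi) = of_real (2 * pi * integral {0..1} (\<lambda>s. w (s * (2 * pi))))"
    by (simp add: antideriv_def)
  show "0 < integral {0..1} (\<lambda>s. w (s * (2 * pi)))"
    using c assms(2) by (rule integral_unit_pos)
qed

text \<open>
  If $\phi$ moved away from $\phi(0)$, then by continuity it would also take a value at a distance
  $d$ from $\phi(0)$ with $0 < d \le 1 < \pi$, where $\sin d \ne 0$.
\<close>

lemma cis_constant_imp_constant:
  fixes \<phi> :: "real \<Rightarrow> real"
  assumes \<phi>: "continuous_on UNIV \<phi>" and cis: "\<And>s. s \<in> {0..a} \<Longrightarrow> cis (\<phi> s) = cis (\<phi> 0)"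
    and s: "s \<in> {0..a}"
  shows "\<phi> s = \<phi> 0"
proof (rule ccontr)
  define d where "d = min 1 \<bar>\<phi> s - \<phi> 0\<bar>"
  assume "\<phi> s \<noteq> \<phi> 0"
  then have d: "0 < d" "d \<le> 1" "d \<le> \<bar>\<phi> s - \<phi> 0\<bar>" by (auto simp: d_def)
  have "continuous_on {0..s} (\<lambda>r. \<bar>\<phi> r - \<phi> 0\<bar>)"
    by (intro continuous_intros continuous_on_subset[OF \<phi>]) auto
  then have "\<exists>r\<ge>0. r \<le> s \<and> \<bar>\<phi> r - \<phi> 0\<bar> = d"
    using d s IVT'[of "\<lambda>r. \<bar>\<phi> r - \<phi> 0\<bar>" 0 d s] by simp
  then obtain r where r: "r \<in> {0..s}" "\<bar>\<phi> r - \<phi> 0\<bar> = d" by auto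
  have "cis (\<phi> r - \<phi> 0) = 1"
    using cis[of r] r s by (simp add: cis_divide[symmetric])
  then have "sin (\<phi> r - \<phi> 0) = 0" by (simp add: complex_eq_iff)
  moreover have "d = \<phi> r - \<phi> 0 \<or> d = - (\<phi> r - \<phi> 0)" using r(2) by linarith
  ultimately have "sin d = 0" by (metis sin_minus minus_zero)
  moreover have "0 < sin d" using d pi_gt3 by (intro sin_gt_zero) auto
  ultimately show False by simp
qed

text \<open>
  The average of unit vectors has norm $1$ only if they all coincide; then $\phi$ is constant modulo
  $2\pi$, hence constant by continuity.
\<close>

lemma norm_mean_direction_less_1:
  assumes w: "continuous_on UNIV w" "\<And>\<theta>. 0 < w \<theta>"
    and \<phi>: "continuous_on UNIV \<phi>" "\<And>\<theta>. \<phi> (\<theta> + 2 * pi) = \<phi> \<theta>" and nonconst: "\<phi> \<theta>\<^sub>1 \<noteq> \<phi> 0"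
  shows "norm (mean_direction w \<phi>) < 1"
proof (rule ccontr)
  assume ge: "\<not> norm (mean_direction w \<phi>) < 1"
  let ?I = "integral {0..1} (\<lambda>s. w (s * (2 * pi)))"
  let ?e = "\<lambda>s. cis (\<phi> (s * (2 * pi)))"
  note I = antideriv_weight_pos[OF w]
  have "norm (mean_direction w \<phi>) = norm (integral {0..1} (\<lambda>s. of_real (w (s * (2 * pi))) * ?e s)) / ?I"
    using I(2) unfolding mean_direction_def I(1) by (simp add: antideriv_def norm_mult norm_divide)
  with ge I(2) have "?I \<le> norm (integral {0..1} (\<lambda>s. of_real (w (s * (2 * pi))) * ?e s))"
    by (simp add: field_simps)
  moreover have "continuous_on {0..1} (\<lambda>s. w (s * (2 * pi)))"
    by (intro continuous_on_compose2[OF w(1)] continuous_intros) auto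
  moreover have "continuous_on {0..1} ?e"
    by (intro continuous_on_cis continuous_on_compose2[OF \<phi>(1)] continuous_intros) auto
  ultimately have e: "?e s = ?e 0" if "s \<in> {0..1}" for s
    using weighted_mean_unimodular[of "\<lambda>s. w (s * (2 * pi))" ?e s] w(2) that by simp
  have cis: "cis (\<phi> r) = cis (\<phi> 0)" if "r \<in> {0..2*pi}" for r
    using e[of "r / (2 * pi)"] that by (simp add: field_simps)
  have "\<phi> r = \<phi> 0" if "r \<in> {0..2*pi}" for r
    by (rule cis_constant_imp_constant[OF \<phi>(1) cis that])
  moreover have "Arg2pi (cis \<theta>\<^sub>1) \<in> {0..2*pi}"
    by (simp add: Arg2pi_ge_0 Arg2pi_lt_2pi[THEN less_imp_le])
  ultimately have "\<phi> (Arg2pi (cis \<theta>\<^sub>1)) = \<phi> 0" by blast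
  then show False using nonconst periodic_Arg2pi_cis[of \<phi>, OF \<phi>(2)] by simp
qed

lemma closed_curve_has_vector_derivative:
  assumes "continuous_on UNIV w" "continuous_on UNIV \<phi>"
  shows "(closed_curve b w \<phi> has_vector_derivative
           of_real (w \<theta>) * (cis (\<phi> \<theta>) - mean_direction w \<phi>)) (at \<theta>)"
proof -
  have "continuous_on UNIV (\<lambda>s. of_real (w s) * (cis (\<phi> s) - mean_direction w \<phi>))"
    by (intro continuous_intros continuous_on_cis assms)
  from antideriv_has_vector_derivative[OF this] show ?thesis
    unfolding closed_curve_def by (auto intro!: derivative_eq_intros)
qed

lemma antideriv_diff_mult:
  assumes "continuous_on UNIV u" "continuous_on UNIV v"
  shows "antideriv (\<lambda>s. u s - v s * m) \<theta> = antideriv u \<theta> - antideriv v \<theta> * m"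
proof -
  have "((\<lambda>t. antideriv u t - antideriv v t * m) has_vector_derivative u t - v t * m) (at t)" for t
    by (intro derivative_intros antideriv_has_vector_derivative assms)
  from antideriv_eq[of \<theta>, OF this] show ?thesis by simp
qed

lemma closed_curve_periodic:
  assumes w: "continuous_on UNIV w" "\<And>\<theta>. 0 < w \<theta>" "\<And>\<theta>. w (\<theta> + 2 * pi) = w \<theta>"
    and \<phi>: "continuous_on UNIV \<phi>" "\<And>\<theta>. \<phi> (\<theta> + 2 * pi) = \<phi> \<theta>"
  shows "closed_curve b w \<phi> (\<theta> + 2 * pi) = closed_curve b w \<phi> \<theta>"
proof -
  let ?m = "mean_direction w \<phi>"
  let ?v = "\<lambda>s. of_real (w s) * (cis (\<phi> s) - ?m)"
  have c: "continuous_on UNIV (\<lambda>s. complex_of_real (w s))"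
    "continuous_on UNIV (\<lambda>s. of_real (w s) * cis (\<phi> s))" "continuous_on UNIV ?v"
    by (intro continuous_intros continuous_on_cis w \<phi>)+
  have "antideriv ?v (2 * pi) = antideriv (\<lambda>s. of_real (w s) * cis (\<phi> s)) (2 * pi)
      - antideriv (\<lambda>s. of_real (w s)) (2 * pi) * ?m"
    unfolding right_diff_distrib by (rule antideriv_diff_mult[OF c(2,1)])
  also have "\<dots> = 0"
    using antideriv_weight_pos[OF w(1,2)] unfolding mean_direction_def by simp
  finally show ?thesis
    using antideriv_periodic[OF c(3), of "2 * pi" \<theta>] w(3) \<phi>(2) by (simp add: closed_curve_def)
qed

text \<open>
  The factor $1 - m e^{-i\phi}$ of the velocity stays in the right half plane, so the principal branch
  supplies a periodic logarithm of it. The other two factors, $w$ and $e^{i\phi}$, have the periodic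
  logarithms $\ln w$ and $i\phi$.
\<close>

lemma rotation_degree_closed_curve:
  assumes w: "continuous_on UNIV w" "\<And>\<theta>. 0 < w \<theta>" "\<And>\<theta>. w (\<theta> + 2 * pi) = w \<theta>"
    and \<phi>: "continuous_on UNIV \<phi>" "\<And>\<theta>. \<phi> (\<theta> + 2 * pi) = \<phi> \<theta>"
    and m: "norm m < 1"
    and deriv: "\<And>\<theta>. circle_deriv 1 c \<theta> = of_real (w \<theta>) * (cis (\<phi> \<theta>) - m)"
  shows "rotation_degree c = 0"
proof -
  have pos: "0 < Re (1 - m * cis (- \<phi> \<theta>))" for \<theta>
    using complex_Re_le_cmod[of "m * cis (- \<phi> \<theta>)"] m by (simp add: norm_mult)
  define q where "q \<theta> = of_real (ln (w \<theta>)) + \<i> * of_real (\<phi> \<theta>) + Ln (1 - m * cis (- \<phi> \<theta>))" for \<theta>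
  have nz: "1 - m * cis (- \<phi> \<theta>) \<noteq> 0" for \<theta>
    using pos[of \<theta>] by (metis less_irrefl zero_complex.simps(1))
  have exp_q: "circle_deriv 1 c \<theta> = exp (q \<theta>)" for \<theta>
  proof -
    have "exp (q \<theta>) = of_real (w \<theta>) * (cis (\<phi> \<theta>) * (1 - m * cis (- \<phi> \<theta>)))"
      using w(2)[of \<theta>] nz[of \<theta>]
      by (simp add: q_def exp_add exp_of_real cis_conv_exp[symmetric] mult.assoc)
    also have "cis (\<phi> \<theta>) * (1 - m * cis (- \<phi> \<theta>)) = cis (\<phi> \<theta>) - m"
      by (simp add: algebra_simps cis_mult)
    finally show ?thesis using deriv by simp
  qed
  have q_cont: "continuous_on UNIV q"
    unfolding q_def using w(2) pos
    by (intro continuous_intros continuous_on_cis w \<phi>)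
       (auto simp: complex_nonpos_Reals_iff not_le less_imp_neq[symmetric])
  have "path (\<lambda>t. q (2 * pi * t))"
    unfolding path_def by (intro continuous_on_compose2[OF q_cont] continuous_intros) auto
  from winding_number_compose_exp[OF this]
  have "rotation_degree c = (q (2 * pi) - q 0) / (2 * of_real pi * \<i>)"
    unfolding rotation_degree_def exp_q by (simp add: o_def pathfinish_def pathstart_def)
  moreover have "q (2 * pi) = q 0"
    using w(3)[of 0] \<phi>(2)[of 0] by (simp add: q_def)
  ultimately show ?thesis by simp
qed

lemma cn_family_cis:
  assumes "cn_family n X (\<lambda>x \<theta>. of_real (\<phi> x \<theta>))"
  shows "cn_family n X (\<lambda>x \<theta>. cis (\<phi> x \<theta>))"
  unfolding cis_conv_exp
  by (intro cn_family_exp cn_family_mult cn_family_parameter assms) simp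

lemma continuous_map_euclidean_divide:
  fixes f g :: "'x \<Rightarrow> complex"
  assumes "continuous_map X euclidean f" "continuous_map X euclidean g"
    and "\<And>x. x \<in> topspace X \<Longrightarrow> g x \<noteq> 0"
  shows "continuous_map X euclidean (\<lambda>x. f x / g x)"
  using assms by (simp add: continuous_map_atin tendsto_divide)

text \<open>
  This reduces a homotopy of immersions of degree $0$ to one of speeds and angles: besides
  positive speed, only the bound on the mean direction has to be kept along it.
\<close>

lemma continuous_map_closed_curve:
  assumes b: "continuous_map X euclidean b"
    and w: "\<And>n. cn_family n X (\<lambda>x \<theta>. of_real (w x \<theta>))"
      "\<And>x \<theta>. x \<in> topspace X \<Longrightarrow> 0 < w x \<theta>"
      "\<And>x \<theta>. x \<in> topspace X \<Longrightarrow> w x (\<theta> + 2 * pi) = w x \<theta>"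
    and \<phi>: "\<And>n. cn_family n X (\<lambda>x \<theta>. of_real (\<phi> x \<theta>))"
      "\<And>x \<theta>. x \<in> topspace X \<Longrightarrow> \<phi> x (\<theta> + 2 * pi) = \<phi> x \<theta>"
    and m: "\<And>x. x \<in> topspace X \<Longrightarrow> norm (mean_direction (w x) (\<phi> x)) < 1"
  shows "continuous_map X Imm0_topology (\<lambda>x. circle_map (closed_curve (b x) (w x) (\<phi> x)))"
proof -
  have real_cont: "continuous_on UNIV (u x)"
    if u: "\<And>n. cn_family n X (\<lambda>x \<theta>. complex_of_real (u x \<theta>))" and x: "x \<in> topspace X" for u x
    using continuous_on_Re[OF continuous_on_slice[OF cn_family_continuous[OF u] x]] by simp
  note cont = real_cont[OF w(1)] real_cont[OF \<phi>(1)]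
  let ?u = "\<lambda>x. closed_curve (b x) (w x) (\<phi> x)"
  have per: "?u x (\<theta> + 2 * pi) = ?u x \<theta>" if "x \<in> topspace X" for x \<theta>
    using cont that w(2,3) \<phi>(2) by (intro closed_curve_periodic)
  have wE: "cn_family n X (\<lambda>x \<theta>. of_real (w x \<theta>) * cis (\<phi> x \<theta>))" for n
    by (intro cn_family_mult cn_family_cis w \<phi>)
  have "antideriv (\<lambda>\<theta>. of_real (w x \<theta>)) (2 * pi) \<noteq> 0" if "x \<in> topspace X" for x
    using antideriv_weight_pos[of "w x"] cont that w(2) by simp
  then have mean: "continuous_map X euclidean (\<lambda>x. mean_direction (w x) (\<phi> x))"
    unfolding mean_direction_def
    by (intro continuous_map_euclidean_divide cn_family_total_integral wE w)
  have "cn_family n X (\<lambda>x \<theta>. of_real (w x \<theta>) * (cis (\<phi> x \<theta>) + - 1 * mean_direction (w x) (\<phi> x)))" for n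
    by (intro cn_family_mult cn_family_add cn_family_cis cn_family_parameter w \<phi> mean) simp
  from cn_family_antideriv[OF this]
  have "cn_family (Suc n) X (\<lambda>x. antideriv (\<lambda>\<theta>. of_real (w x \<theta>) * (cis (\<phi> x \<theta>) - mean_direction (w x) (\<phi> x))))" for n
    by simp
  from cn_family_add[OF cn_family_parameter[OF b] cn_family_Suc_imp[OF this]]
  have fam: "cn_family n X ?u" for n
    unfolding closed_curve_def .
  have "circle_map (?u x) \<in> Imm0" if x: "x \<in> topspace X" for x
  proof -
    have smooth: "circle_map (?u x) \<in> smooth_maps"
      using fam x per[OF x] by (rule circle_map_smooth)
    have "circle_deriv 1 (circle_map (?u x)) = vderiv (?u x)"
      using circle_deriv_circle_map[of "?u x" 1, OF per[OF x]] by simp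
    then have d: "circle_deriv 1 (circle_map (?u x)) \<theta> =
        of_real (w x \<theta>) * (cis (\<phi> x \<theta>) - mean_direction (w x) (\<phi> x))" for \<theta>
      using closed_curve_has_vector_derivative[OF cont(1)[OF x] cont(2)[OF x]] by (simp add: vector_derivative_at)
    have "cis (\<phi> x \<theta>) \<noteq> mean_direction (w x) (\<phi> x)" for \<theta>
      using m[OF x] by (metis norm_cis less_irrefl)
    then have "circle_deriv 1 (circle_map (?u x)) \<theta> \<noteq> 0" for \<theta>
      unfolding d using w(2)[OF x, of \<theta>] by simp
    then have "circle_map (?u x) \<in> immersions"
      using smooth by (simp add: immersions_def del: One_nat_def)
    moreover have "rotation_degree (circle_map (?u x)) = 0"
      using cont(1)[OF x] w(2,3)[OF x] cont(2)[OF x] \<phi>(2)[OF x] m[OF x] d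
      by (rule rotation_degree_closed_curve)
    ultimately show ?thesis by (simp add: Imm0_def)
  qed
  then show ?thesis
    unfolding Imm0_topology_def continuous_map_in_subtopology
    using continuous_map_circle_map[of X ?u, OF fam per] by auto
qed

section \<open>A tangent angle in general position\<close>

text \<open>
  For $k = 1$ and $k = 2$ the function is $\cos\theta$ and $\cos 2\theta$. If both were affine
  functions of $\psi$ up to bijections of the circle, then $\operatorname{Re} z^2$ would be an affine
  function of $\operatorname{Re} h(z)$ with a bijection $h$. The maximum of $\operatorname{Re} z^2$
  is taken at $1$ and $-1$, so $\operatorname{Re} h(1) = \operatorname{Re} h(-1)$ would be an extreme
  value of the real part on the circle, which is taken only once.
\<close>

lemma exists_transverse_angle:
  fixes \<psi> :: "complex \<Rightarrow> real"
  obtains k :: nat where "\<And>f A B. bij_betw f circle circle \<Longrightarrow>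
    \<exists>z\<in>circle. Re (z ^ k) \<noteq> A + B * \<psi> (f z)"
proof -
  have False
    if f: "bij_betw f circle circle" "\<And>z. z \<in> circle \<Longrightarrow> Re (z ^ 1) = A + B * \<psi> (f z)"
      and g: "bij_betw g circle circle" "\<And>z. z \<in> circle \<Longrightarrow> Re (z ^ 2) = A' + B' * \<psi> (g z)"
    for f g A B A' B'
  proof -
    define h where "h z = inv_into circle f (g z)" for z
    have "g z \<in> f ` circle" if "z \<in> circle" for z
      using that f(1) g(1) unfolding bij_betw_def by blast
    then have h: "h z \<in> circle" "f (h z) = g z" if "z \<in> circle" for z
      using that unfolding h_def by (blast intro: inv_into_into f_inv_into_f)+
    have h_inj: "h 1 \<noteq> h (- 1)"
    proof
      assume "h 1 = h (- 1)"
      then have "g 1 = g (- 1)" using h(2)[of 1] h(2)[of "- 1"] by simp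
      then show False using g(1) unfolding bij_betw_def by (auto dest!: inj_onD)
    qed
    have h_surj: "\<exists>z\<in>circle. h z = y" if "y \<in> circle" for y
    proof -
      have "f y \<in> g ` circle" using that f(1) g(1) unfolding bij_betw_def by blast
      then obtain z where z: "z \<in> circle" "f y = g z" by blast
      then have "h z = y"
        using h[OF z(1)] that f(1) unfolding bij_betw_def by (metis inj_onD)
      with z show ?thesis by blast
    qed
    have "B \<noteq> 0"
      using f(2)[of 1] f(2)[of "- 1"] by auto
    define q where "q = B' / B"
    have rel: "Re (z ^ 2) = A' + q * (Re (h z) - A)" if "z \<in> circle" for z
      using g(2)[OF that] f(2)[OF h(1)[OF that]] h(2)[OF that] \<open>B \<noteq> 0\<close> by (simp add: q_def)
    have "q \<noteq> 0"
      using rel[of 1] rel[of \<i>] by auto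
    define x where "x = Re (h 1)"
    have x: "Re (h (- 1)) = x"
    proof -
      have "A' + q * (Re (h 1) - A) = 1" "A' + q * (Re (h (- 1)) - A) = 1"
        using rel[of 1] rel[of "- 1"] by simp_all
      then have "q * (Re (h (- 1)) - A) = q * (Re (h 1) - A)" by linarith
      then show ?thesis using \<open>q \<noteq> 0\<close> by (simp add: x_def)
    qed
    have max: "q * (Re y - x) \<le> 0" if y: "y \<in> circle" for y
    proof -
      obtain z where z: "z \<in> circle" "h z = y" using h_surj[OF y] by blast
      have "Re (z ^ 2) \<le> 1"
        using complex_Re_le_cmod[of "z ^ 2"] z(1) by (simp add: norm_power)
      then show ?thesis using rel[OF z(1)] rel[of 1] z(2) by (simp add: x_def algebra_simps)
    qed
    have hc: "norm (h 1) = 1" "norm (h (- 1)) = 1" using h(1)[of 1] h(1)[of "- 1"] by simp_all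
    \<comment> \<open>The sign of $q$ decides whether $x$ is the maximum $1$ or the minimum $-1$.\<close>
    have "\<bar>x\<bar> \<le> 1" using abs_Re_le_cmod[of "h 1"] hc by (simp add: x_def)
    then have "\<bar>x\<bar> = 1"
      using max[of 1] max[of "- 1"] \<open>q \<noteq> 0\<close> by (auto simp: mult_le_0_iff)
    then have "x\<^sup>2 = 1" by (simp add: abs_square_eq_1)
    then have "Im (h 1) = 0" "Im (h (- 1)) = 0"
      using hc cmod_power2[of "h 1"] cmod_power2[of "h (- 1)"] x by (simp_all add: x_def)
    then have "h 1 = h (- 1)" using x by (simp add: complex_eq_iff x_def)
    with h_inj show False ..
  qed
  then show thesis using that[of 1] that[of 2] by metis
qed

section \<open>Reparametrisations\<close>

text \<open>
  The derivative of any local lift of $f$ to the angle. Taking the component along the tangent vector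
  $i f$ expresses it by products, so that it is a smooth family over the group.
\<close>

definition angular_speed :: "(complex \<Rightarrow> complex) \<Rightarrow> real \<Rightarrow> real" where
  "angular_speed f \<theta> = Re (circle_deriv 1 f \<theta> * cnj (\<i> * f (cis \<theta>)))"

lemma Diff_plus_norm:
  assumes "f \<in> Diff_plus"
  shows "norm (f (cis \<theta>)) = 1"
proof -
  have "f (cis \<theta>) \<in> circle"
    using assms bij_betw_apply[of f circle circle "cis \<theta>"]
    by (simp add: Diff_plus_def diffeomorphisms_def)
  then show ?thesis by simp
qed

lemma Diff_plus_angular_speed:
  assumes f: "f \<in> Diff_plus"
  shows "circle_deriv 1 f \<theta> = of_real (angular_speed f \<theta>) * (\<i> * f (cis \<theta>))"
    and "0 < angular_speed f \<theta>"
proof -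
  obtain r where r: "0 < r" "circle_deriv 1 f \<theta> = of_real r * (\<i> * f (cis \<theta>))"
    using f by (auto simp: Diff_plus_def orientation_preserving_def)
  have "(\<i> * f (cis \<theta>)) * cnj (\<i> * f (cis \<theta>)) = 1"
    using Diff_plus_norm[OF f, of \<theta>] complex_norm_square[of "\<i> * f (cis \<theta>)"]
    by (simp add: norm_mult)
  then have "angular_speed f \<theta> = r"
    unfolding angular_speed_def r(2) by (simp only: mult.assoc) simp
  with r show "circle_deriv 1 f \<theta> = of_real (angular_speed f \<theta>) * (\<i> * f (cis \<theta>))"
    and "0 < angular_speed f \<theta>" by simp_all
qed

lemma cn_family_of_real_Re:
  "cn_family n X u \<Longrightarrow> cn_family n X (\<lambda>x \<theta>. of_real (Re (u x \<theta>)))"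
  by (rule cn_family_bounded_linear[of "\<lambda>z. of_real (Re z)"])
     (intro bounded_linear_compose[OF bounded_linear_of_real] bounded_linear_Re)

lemma cn_family_of_real_Im:
  "cn_family n X u \<Longrightarrow> cn_family n X (\<lambda>x \<theta>. of_real (Im (u x \<theta>)))"
  by (rule cn_family_bounded_linear[of "\<lambda>z. of_real (Im z)"])
     (intro bounded_linear_compose[OF bounded_linear_of_real] bounded_linear_Im)

lemma cn_family_diffeomorphism:
  "cn_family n Diff_plus_topology (\<lambda>f \<theta>. f (cis \<theta>))"
  "cn_family n Diff_plus_topology (\<lambda>f \<theta>. of_real (angular_speed f \<theta>))"
proof -
  have *: "cn_family n Diff_plus_topology (\<lambda>f. circle_deriv k f)" for k
    using cn_family_pullback[OF continuous_map_into_fulltopology[OF continuous_map_id] cn_family_circle_deriv]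
    unfolding Diff_plus_topology_def by simp
  from *[of 0] show F: "cn_family n Diff_plus_topology (\<lambda>f \<theta>. f (cis \<theta>))"
    by (simp add: circle_deriv_def)
  show "cn_family n Diff_plus_topology (\<lambda>f \<theta>. of_real (angular_speed f \<theta>))"
    unfolding angular_speed_def
    by (intro cn_family_of_real_Re cn_family_mult *
        cn_family_bounded_linear[OF bounded_linear_cnj] F cn_family_parameter) simp
qed

lemma topspace_Diff_plus_topology: "topspace Diff_plus_topology = Diff_plus"
  by (auto simp: Diff_plus_topology_def Diff_plus_def diffeomorphisms_def)

section \<open>The homotopy\<close>

theorem lemma4p2:
  fixes c :: "complex \<Rightarrow> complex"
  assumes "c \<in> Imm0"
  shows "\<exists>c0. homotopic_with (\<lambda>_. True) Diff_plus_topology Imm0_topology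
           (\<lambda>f. compose circle c f) (\<lambda>_. c0)"
proof -
  have c: "c \<in> smooth_maps" using assms by (simp add: Imm0_def immersions_def)
  obtain L where L: "\<And>\<theta>. circle_deriv 1 c \<theta> = exp (L \<theta>)" "\<And>\<theta>. L (\<theta> + 2 * pi) = L \<theta>"
    "\<And>n. cn_family n (discrete_topology {()}) (\<lambda>_. L)"
    using assms by (rule Imm0_smooth_logarithm) blast
  \<comment> \<open>From now on the logarithm of the velocity is a function on the circle, which can be composed
    with diffeomorphisms.\<close>
  define l where "l = circle_map L"
  have l_cis: "l (cis \<theta>) = L \<theta>" for \<theta>
    using circle_map_cis[of L, OF L(2)] by (simp add: l_def)
  have c': "((\<lambda>\<theta>. c (cis \<theta>)) has_vector_derivative exp (l (cis \<theta>))) (at \<theta>)" for \<theta>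
    using circle_deriv_has_vector_derivative[OF c, of 0 \<theta>] L(1)
    by (simp add: circle_deriv_def l_cis)
  obtain k :: nat where k: "\<And>f A B. bij_betw f circle circle \<Longrightarrow>
      \<exists>z\<in>circle. Re (z ^ k) \<noteq> A + B * Im (l (f z))"
    by (rule exists_transverse_angle[of "\<lambda>z. Im (l z)"]) blast
  \<comment> \<open>Straight lines from the speed and angle of $c \circ f$ to $1$ and $\operatorname{Re} z^k$. The
    base point moves to $0$ so that the final curve is the same for all $f$.\<close>
  define speed where "speed f \<theta> = angular_speed f \<theta> * exp (Re (l (f (cis \<theta>))))" for f \<theta>
  define w where "w = (\<lambda>(t, f) \<theta>. (1 - t) * speed f \<theta> + t)"
  define \<phi> where "\<phi> = (\<lambda>(t, f :: complex \<Rightarrow> complex) \<theta>.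
      (1 - t) * Im (l (f (cis \<theta>))) + t * Re (cis \<theta> ^ k))"
  define b where "b = (\<lambda>(t, f :: complex \<Rightarrow> complex). of_real (1 - t) * c (f 1))"
  define H where "H x = circle_map (closed_curve (b x) (w x) (\<phi> x))" for x
  let ?X = "prod_topology (top_of_set {0..1::real}) Diff_plus_topology"

  have velocity: "((\<lambda>\<theta>. c (f (cis \<theta>))) has_vector_derivative
      of_real (w (0, f) \<theta>) * cis (\<phi> (0, f) \<theta>)) (at \<theta>)" if f: "f \<in> Diff_plus" for f \<theta>
  proof -
    have "f \<in> smooth_maps" using f by (simp add: Diff_plus_def diffeomorphisms_def)
    from circle_deriv_has_vector_derivative[OF this, of 0 \<theta>]
    have "((\<lambda>\<theta>. f (cis \<theta>)) has_vector_derivative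
        of_real (angular_speed f \<theta>) * (\<i> * f (cis \<theta>))) (at \<theta>)"
      using Diff_plus_angular_speed(1)[OF f, of \<theta>] by (simp add: circle_deriv_def)
    from circle_chain_rule[OF Diff_plus_norm[OF f] this c']
    show ?thesis
      by (simp add: w_def \<phi>_def speed_def exp_eq_polar[of "l (f (cis \<theta>))"] mult.assoc exp_of_real)
  qed
  have antideriv_velocity: "antideriv (\<lambda>\<theta>. of_real (w (0, f) \<theta>) * cis (\<phi> (0, f) \<theta>)) \<theta> =
      c (f (cis \<theta>)) - c (f 1)" if "f \<in> Diff_plus" for f \<theta>
    using antideriv_eq[of \<theta>, OF velocity[OF that]] by simp
  \<comment> \<open>The curve $c \circ f$ is closed, so at time $0$ the velocity needs no correction.\<close>
  have mean_0: "mean_direction (w (0, f)) (\<phi> (0, f)) = 0" if f: "f \<in> Diff_plus" for f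
    using antideriv_velocity[OF f, of "2 * pi"] by (simp add: mean_direction_def)

  have t_fam: "cn_family n ?X (\<lambda>x \<theta>. of_real (fst x))" for n
  proof (rule cn_family_parameter)
    have "continuous_map ?X euclideanreal fst"
      by (rule continuous_map_into_fulltopology[OF continuous_map_fst])
    from continuous_map_compose[OF this, of euclidean complex_of_real]
    show "continuous_map ?X euclidean (\<lambda>x. complex_of_real (fst x))"
      by (simp add: o_def continuous_on_of_real_id)
  qed
  have s_fam: "cn_family n ?X (\<lambda>x \<theta>. 1 + - 1 * of_real (fst x))" for n
    by (intro cn_family_add cn_family_mult t_fam cn_family_parameter) simp_all
  note F_fam = cn_family_pullback[OF continuous_map_snd cn_family_diffeomorphism(1)]
    and r_fam = cn_family_pullback[OF continuous_map_snd cn_family_diffeomorphism(2)]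
  have l_fam: "cn_family n ?X (\<lambda>x \<theta>. l (snd x (cis \<theta>)))" for n
  proof (rule cn_family_compose_circle[where g = l and F = "\<lambda>x \<theta>. snd x (cis \<theta>)"
        and Y = "discrete_topology {()}" and y = "()" and r = "\<lambda>x. angular_speed (snd x)"])
    show "cn_family n (discrete_topology {()}) (\<lambda>_ \<theta>. l (cis \<theta>))"
      using L(3) by (simp add: l_cis)
    show "((\<lambda>\<theta>. snd x (cis \<theta>)) has_vector_derivative
        of_real (angular_speed (snd x) \<theta>) * (\<i> * snd x (cis \<theta>))) (at \<theta>)"
      if "x \<in> topspace ?X" for x \<theta>
    proof -
      have f: "snd x \<in> Diff_plus" using that by (auto simp: topspace_Diff_plus_topology)
      then have "snd x \<in> smooth_maps" by (simp add: Diff_plus_def diffeomorphisms_def)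
      from circle_deriv_has_vector_derivative[OF this, of 0 \<theta>] show ?thesis
        using Diff_plus_angular_speed(1)[OF f, of \<theta>] by (simp add: circle_deriv_def)
    qed
  qed (auto intro: F_fam r_fam simp: topspace_Diff_plus_topology Diff_plus_norm)
  have w_fam: "cn_family n ?X (\<lambda>x \<theta>. of_real (w x \<theta>))" for n
  proof -
    have "cn_family n ?X (\<lambda>x \<theta>. (1 + - 1 * of_real (fst x)) *
        (of_real (angular_speed (snd x) \<theta>) * exp (of_real (Re (l (snd x (cis \<theta>)))))) + of_real (fst x))"
      by (intro cn_family_add cn_family_mult cn_family_exp cn_family_of_real_Re l_fam r_fam s_fam t_fam)
    then show ?thesis by (simp add: w_def speed_def case_prod_unfold exp_of_real)
  qed
  have \<phi>_fam: "cn_family n ?X (\<lambda>x \<theta>. of_real (\<phi> x \<theta>))" for n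
  proof -
    have "cn_family n ?X (\<lambda>x \<theta>. (1 + - 1 * of_real (fst x)) * of_real (Im (l (snd x (cis \<theta>)))) +
        of_real (fst x) * of_real (Re (exp (of_nat k * (\<i> * of_real \<theta>)))))"
      by (intro cn_family_add cn_family_mult cn_family_exp cn_family_of_real_Re cn_family_of_real_Im
          l_fam s_fam t_fam cn_family_angle cn_family_parameter) simp_all
    \<comment> \<open>De Moivre: $\operatorname{Re} z^k$ is the real part of $e^{ik\theta}$.\<close>
    then show ?thesis
      by (simp add: \<phi>_def case_prod_unfold exp_of_nat_mult cis_conv_exp)
  qed
  have b_cont: "continuous_map ?X euclidean b"
  proof -
    have "continuous_on circle c"
      using c' by (intro continuous_on_circle continuous_at_imp_continuous_on ballI
          has_vector_derivative_continuous)
    moreover have eval: "continuous_map ?X euclidean (\<lambda>x. u x 0)"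
      if "cn_family 0 ?X u" for u
    proof -
      have "continuous_map ?X (prod_topology ?X euclideanreal) (\<lambda>x. (x, 0))"
        by (intro continuous_map_pairedI) auto
      from continuous_map_compose[OF this cn_family_continuous[OF that]]
      show ?thesis by (simp add: o_def)
    qed
    moreover have "snd x (cis 0) \<in> circle" if "x \<in> topspace ?X" for x
      using that Diff_plus_norm[of "snd x" 0] by (auto simp: topspace_Diff_plus_topology)
    ultimately have "continuous_map ?X euclidean (\<lambda>x. c (snd x (cis 0)))"
      using continuous_map_euclidean_compose_on[OF eval[OF F_fam]] by blast
    from continuous_map_euclidean_mult[OF eval[OF s_fam] this]
    show ?thesis by (simp add: b_def case_prod_unfold)
  qed

  have "continuous_map ?X Imm0_topology H"
    unfolding H_def
  proof (rule continuous_map_closed_curve[OF b_cont w_fam _ _ \<phi>_fam])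
    fix x assume "x \<in> topspace ?X"
    then obtain t f where x: "x = (t, f)" "0 \<le> t" "t \<le> 1" "f \<in> Diff_plus"
      by (cases x) (auto simp: topspace_Diff_plus_topology)
    have speed_pos: "0 < speed f \<theta>" for \<theta>
      using Diff_plus_angular_speed(2)[OF x(4)] by (simp add: speed_def)
    show w_pos: "0 < w x \<theta>" for \<theta>
      using x speed_pos[of \<theta>]
      by (cases "t = 1") (auto simp: w_def intro!: add_pos_nonneg)
    have f: "f \<in> smooth_maps" using x by (simp add: Diff_plus_def diffeomorphisms_def)
    show "w x (\<theta> + 2 * pi) = w x \<theta>" for \<theta>
      using circle_deriv_periodic[OF f, of 1 \<theta>]
      by (simp add: w_def x speed_def angular_speed_def cis_periodic)
    show \<phi>_per: "\<phi> x (\<theta> + 2 * pi) = \<phi> x \<theta>" for \<theta>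
      by (simp add: \<phi>_def x cis_periodic)
    show "norm (mean_direction (w x) (\<phi> x)) < 1"
    proof (cases "t = 0")
      case True
      then show ?thesis using mean_0 x by simp
    next
      case False
      have cont: "continuous_on UNIV (w x)" "continuous_on UNIV (\<phi> x)"
        using continuous_on_Re[OF continuous_on_slice[OF cn_family_continuous[OF w_fam] \<open>x \<in> topspace ?X\<close>]]
          continuous_on_Re[OF continuous_on_slice[OF cn_family_continuous[OF \<phi>_fam] \<open>x \<in> topspace ?X\<close>]]
        by simp_all
      \<comment> \<open>If $\phi$ were constant, solving its definition for $\operatorname{Re} z^k$ would express it by
        $\psi \circ f$ with the following coefficients.\<close>
      have "bij_betw f circle circle" using x by (simp add: Diff_plus_def diffeomorphisms_def)
      from k[OF this, of "\<phi> x 0 / t" "- (1 - t) / t"] obtain z where z: "z \<in> circle"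
        "Re (z ^ k) \<noteq> \<phi> x 0 / t + - (1 - t) / t * Im (l (f z))" by blast
      have "\<phi> x (Arg z) = (1 - t) * Im (l (f z)) + t * Re (z ^ k)"
        using z(1) cis_Arg_unit[of z] by (simp add: \<phi>_def x)
      then have "\<phi> x (Arg z) \<noteq> \<phi> x 0"
        using z(2) False by (auto simp: field_simps)
      with cont w_pos \<phi>_per show ?thesis by (intro norm_mean_direction_less_1)
    qed
  qed
  moreover have "H (0, f) = compose circle c f" if f: "f \<in> Diff_plus" for f
    unfolding H_def
  proof (rule circle_map_eqI)
    show "closed_curve (b (0, f)) (w (0, f)) (\<phi> (0, f)) \<theta> = compose circle c f (cis \<theta>)" for \<theta>
      using antideriv_velocity[OF f, of \<theta>] mean_0[OF f]
      by (simp add: closed_curve_def b_def compose_def)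
  qed simp
  moreover have "H (1, f) = H (1, id)" for f
    by (simp add: H_def b_def w_def \<phi>_def)
  ultimately show ?thesis
    by (subst homotopic_with) (auto intro!: exI[of _ "H (1, id)"] exI[of _ H] simp: topspace_Diff_plus_topology)
qed

end
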